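(* For each letter $n\ge 3$ there exists a finite word $Y_n$ such that $L(n) = Y_n\,\rho(\alpha(L(\varepsilon)))$.
   Context: All words are over the alphabet $\mathbb{N}=\{0,1,2,\dots\}$; letters are written as numerals, so e.g. $202101$ denotes the word with letters $2,0,2,1,0,1$, and juxtaposition denotes concatenation. Positions are indexed from $0$. For a word $w$, $w[i]$ is its letter at position $i$, $w[i:j]=w[i]w[i+1]\cdots w[j-1]$, $w[:j]=w[0:j]$, $w[i:]=w[i:|w|]$, and negative indices count from the end (so $w[:-k]$ is $w$ with its last $k$ letters deleted and $w[-k:]$ is the suffix of length $k$). For a nonempty finite word $w$, $w^+$ is $w$ with its last letter increased by $1$. A square is a nonempty word of the form $yy$; a word is square-free if it has no square factor. For words $u,v$, $u\prec v$ means there is $i$ with $u[:i]=v[:i]$ and $u[i]<v[i]$. For a finite word $w$, $L(w)$ is the lexicographically least infinite word over $\mathbb{N}$ that begins with $w$ and whose only square factors are contained in the prefix $w$; $\varepsilon$ is the empty word. The ruler morphism is $\rho(n)=0\,(n+1)$; $L(\varepsilon)=\rho^\infty(0)=0102010301020104\cdots$ (the ruler sequence), and $R_n=\rho^n(0)$ is its prefix of length $2^n$. A morphism $\phi$ is applied letter by letter: $\phi(w_0w_1\cdots)=\phi(w_0)\phi(w_1)\cdots$, also to infinite words. Define $P_0(n)=R_{n+1}[:-2]$ for $n\ge 0$. Define the morphism $\psi_1$ by $\psi_1(0)=202101$ and $\psi_1(n)=(n+1)\,P_0(n+1)$ for $n\ge1$, and set $P_1(n)=\psi_1(P_0(n-1))$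 for $n\ge 2$. Define the morphism $\psi_2$ by $\psi_2(n)=(n+2)\,P_0(n+2)\,P_1(n+2)$ for $n\ge1$ and $\psi_2(0)$ equal to the following 199-letter word (all letters single digits): 2021020102101201020120210120102013010201030102012021012010201 2021013010201030102012021012010201202301020103010201202101201 0201203010201030102030103020102030102010301020301030201202101 2010201202101202 (concatenate the four pieces). Let $C=0102030102$, $B_0=0301\;\psi_1(1010)[:-3]\;\psi_2(1010)[:-6]\;\psi_2(10)[:-12]\;301020$ (length $798$), $B_1=\rho(B_0[7:-5])$, $E=0102\,B_0\,1\,B_0[:-9]$, $F=B_0[-9:]\,3010302\,C\,0103\,C^+\,02$. The morphism $\alpha$ is defined by $\alpha(0)=EFE$, $\alpha(1)=B_1\,R_4\,C\,B_1\,R_4$, and $\alpha(n)=\alpha(n-1)^+\,R_{n+3}\,C\,\alpha(n-1)^+\,R_{n+3}$ for $n\ge2$. *)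

theory Defs
  imports "HOL-Library.Stream"
begin

text \<open>
  Words over the natural numbers: finite words are lists, infinite words are streams.
\<close>

definition square :: "nat list \<Rightarrow> bool" where
  "square w \<longleftrightarrow> (\<exists>y. y \<noteq> [] \<and> w = y @ y)"

definition lex_less :: "nat stream \<Rightarrow> nat stream \<Rightarrow> bool" (infix \<open>\<prec>\<close> 50) where
  "u \<prec> v \<longleftrightarrow> (\<exists>i. stake i u = stake i v \<and> u !! i < v !! i)"

text \<open>
  The factor of \<open>x\<close> of length \<open>n\<close> at position \<open>i\<close> is \<open>stake n (sdrop i x)\<close>; "contained in the
  prefix \<open>w\<close>" refers to occurrences of squares, so a square occurring inside \<open>w\<close> may
  not occur again further to the right.
\<close>

definition squarefree_ext :: "nat list \<Rightarrow> nat stream \<Rightarrow> bool" where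
  "squarefree_ext w x \<longleftrightarrow>
     stake (length w) x = w \<and>
     (\<forall>i n. square (stake n (sdrop i x)) \<longrightarrow> i + n \<le> length w)"

definition L :: "nat list \<Rightarrow> nat stream" where
  "L w = (THE x. squarefree_ext w x \<and> (\<forall>y. squarefree_ext w y \<longrightarrow> x = y \<or> x \<prec> y))"

definition morph :: "(nat \<Rightarrow> nat list) \<Rightarrow> nat list \<Rightarrow> nat list" where
  "morph \<phi> w = concat (map \<phi> w)"

text \<open>The following is the intended image only if no letter is mapped to the empty word.\<close>

definition smorph :: "(nat \<Rightarrow> nat list) \<Rightarrow> nat stream \<Rightarrow> nat stream" where
  "smorph \<phi> x = flat (smap \<phi> x)"

definition drop_last :: "nat \<Rightarrow> nat list \<Rightarrow> nat list" where  \<comment> \<open>\<open>w[:-k]\<close>\<close>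
  "drop_last k w = take (length w - k) w"

definition take_last :: "nat \<Rightarrow> nat list \<Rightarrow> nat list" where  \<comment> \<open>\<open>w[-k:]\<close>\<close>
  "take_last k w = drop (length w - k) w"

definition inc_last :: "nat list \<Rightarrow> nat list" where  \<comment> \<open>\<open>w\<^sup>+\<close>, for nonempty \<open>w\<close>\<close>
  "inc_last w = butlast w @ [last w + 1]"

definition rho :: "nat \<Rightarrow> nat list" where
  "rho n = [0, n + 1]"

definition ruler :: "nat \<Rightarrow> nat list" where  \<comment> \<open>\<open>R\<^sub>n\<close>\<close>
  "ruler n = (morph rho ^^ n) [0]"

definition P0 :: "nat \<Rightarrow> nat list" where
  "P0 n = drop_last 2 (ruler (n + 1))"

definition psi1 :: "nat \<Rightarrow> nat list" where
  "psi1 n = (if n = 0 then [2,0,2,1,0,1] else [n + 1] @ P0 (n + 1))"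

definition P1 :: "nat \<Rightarrow> nat list" where  \<comment> \<open>meaningful for \<open>n \<ge> 2\<close> only\<close>
  "P1 n = morph psi1 (P0 (n - 1))"

definition psi2_zero :: "nat list" where
  "psi2_zero =
     [2,0,2,1,0,2,0,1,0,2,1,0,1,2,0,1,0,2,0,1,2,0,2,1,0,1,2,0,1,0,2,0,1,3,0,1,0,2,0,1,0,
      3,0,1,0,2,0,1,2,0,2,1,0,1,2,0,1,0,2,0,1,
      2,0,2,1,0,1,3,0,1,0,2,0,1,0,3,0,1,0,2,0,1,2,0,2,1,0,1,2,0,1,0,2,0,1,2,0,2,3,0,1,0,
      2,0,1,0,3,0,1,0,2,0,1,2,0,2,1,0,1,2,0,1,
      0,2,0,1,2,0,3,0,1,0,2,0,1,0,3,0,1,0,2,0,3,0,1,0,3,0,2,0,1,0,2,0,3,0,1,0,2,0,1,0,3,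
      0,1,0,2,0,3,0,1,0,3,0,2,0,1,2,0,2,1,0,1,
      2,0,1,0,2,0,1,2,0,2,1,0,1,2,0,2]"

definition psi2 :: "nat \<Rightarrow> nat list" where
  "psi2 n = (if n = 0 then psi2_zero else [n + 2] @ P0 (n + 2) @ P1 (n + 2))"

definition C_word :: "nat list" where
  "C_word = [0,1,0,2,0,3,0,1,0,2]"

definition B0 :: "nat list" where
  "B0 = [0,3,0,1] @ drop_last 3 (morph psi1 [1,0,1,0]) @ drop_last 6 (morph psi2 [1,0,1,0])
        @ drop_last 12 (morph psi2 [1,0]) @ [3,0,1,0,2,0]"

definition B1 :: "nat list" where
  "B1 = morph rho (drop 7 (drop_last 5 B0))"

definition E_word :: "nat list" where
  "E_word = [0,1,0,2] @ B0 @ [1] @ drop_last 9 B0"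

definition F_word :: "nat list" where
  "F_word = take_last 9 B0 @ [3,0,1,0,3,0,2] @ C_word @ [0,1,0,3] @ inc_last C_word @ [0,2]"

fun alpha :: "nat \<Rightarrow> nat list" where
  "alpha 0 = E_word @ F_word @ E_word"
| "alpha (Suc 0) = B1 @ ruler 4 @ C_word @ B1 @ ruler 4"
| "alpha (Suc (Suc n)) =
     inc_last (alpha (Suc n)) @ ruler (Suc (Suc n) + 3) @ C_word
     @ inc_last (alpha (Suc n)) @ ruler (Suc (Suc n) + 3)"

end

(*
  A word that contains no letter above m splits at the occurrences of m into blocks with letters
  below m. If the blocks are square-free, then a square in the whole word contains m, hence spans
  blocks x, bs, g, bs, z, and it exists iff the common suffix of x and g and the common prefix of
  g and z cover g. In the same way, writing a smaller letter c into z completes a square containing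
  m iff c is the letter of g at the first difference of g and z and the rest of g is a suffix of x.
  So square-freeness and greediness of a word can be decided from the lengths of common prefixes
  and suffixes of its blocks, recursively in m.

  L(n) is the only square-free word starting with n in which no later letter can be decreased
  without completing a square. For n >= 6 only finitely many block patterns occur, independently of
  n: let r be the ruler word R_M without its last letter. Cutting at M turns the prefixes of L(n)
  into sequences of r and a few words Q, D, A, B, J that grow by
    Q' = Q r Q r,  D' = D r Q r D r Q r,  A' = r A r A,  B' = r A r B r A r B,
    J' = r A r B r A r J r Q r D r Q r,
  where the separating letter M is left out. All common prefix and suffix lengths follow linear
  recurrences, so one symbolic computation does the induction step. Its start and the cases
  n = 3, 4, 5 are words of up to 42147 letters over {0,...,5}, which are handled by the same
  recursion on a grammar with 78 rows.
*)
theory Submission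
  imports Defs "HOL-Library.Sublist"
begin

section \<open>Words cut at a letter\<close>

text \<open>Greediness is not inherited by blocks: taken alone, \<open>Q_word\<close> would allow
  its letter 4 at position 11 to be lowered to 2, and only the blocks before it forbid this. Each
  block therefore carries a list of such exceptions, which joining has to remove; L(n) is reached
  when only exceptions at its first letter remain. A list may be too long but never too short, since
  all that matters is that the final one is harmless.

  The end of a block is recorded as the letter m. That is the letter following the block when blocks
  are joined at m, so only the end of the last block needs separate treatment: there the marker
  becomes m + 1.

  The symbolic recurrence starts at M = 6 because it unfolds \<open>alpha (M - 4)\<close> into
  \<open>alpha (M - 5)\<close>, and the recursive equation of \<open>alpha\<close> leads back no
  further than \<open>alpha 1\<close>.

  Y_n is never written down. The table records that \<open>D_word M\<close> is a suffix of the
  current prefix of L(n), and Y_n is whatever precedes it. Passing from M to M + 1 appends the same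
  blocks to this prefix and to \<open>D_word M\<close>, so Y_n stays fixed.\<close>

definition squarefree :: "nat list \<Rightarrow> bool" where
  "squarefree w \<longleftrightarrow> (\<forall>u y v. w = u @ y @ y @ v \<longrightarrow> y = [])"

definition ends_in_square :: "nat list \<Rightarrow> bool" where
  "ends_in_square w \<longleftrightarrow> (\<exists>u y. y \<noteq> [] \<and> w = u @ y @ y)"

text \<open>The obstructions to \<open>w\<close> being greedy when a letter \<open>\<ge> m\<close> follows.\<close>

definition unblocked :: "nat \<Rightarrow> nat list \<Rightarrow> (nat \<times> nat) set" where
  "unblocked m w = {(q, c). q \<le> length w \<and> c < (w @ [m]) ! q \<and> \<not> ends_in_square (take q w @ [c])}"

fun join :: "nat \<Rightarrow> nat list list \<Rightarrow> nat list" where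
  "join m [] = []"
| "join m [a] = a"
| "join m (a # b # as) = a @ m # join m (b # as)"

definition sepcat :: "nat \<Rightarrow> nat list list \<Rightarrow> nat list" where
  "sepcat m as = concat (map (\<lambda>a. a @ [m]) as)"

definition below :: "nat \<Rightarrow> nat list \<Rightarrow> bool" where
  "below m w \<longleftrightarrow> (\<forall>c\<in>set w. c < m)"

lemma below_simps [simp]:
  "below m []" "below m (c # w) \<longleftrightarrow> c < m \<and> below m w" "below m (u @ v) \<longleftrightarrow> below m u \<and> below m v"
  "below m (rev w) \<longleftrightarrow> below m w"
  by (auto simp: below_def)

lemma below_not_in: "below m w \<Longrightarrow> m \<notin> set w"
  by (auto simp: below_def)

lemma sepcat_simps [simp]:
  "sepcat m [] = []" "sepcat m (a # as) = a @ m # sepcat m as"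
  "sepcat m (as @ bs) = sepcat m as @ sepcat m bs"
  by (auto simp: sepcat_def)

lemma join_Cons: "as \<noteq> [] \<Longrightarrow> join m (a # as) = a @ m # join m as"
  by (cases as) auto

lemma join_snoc: "join m (as @ [t]) = sepcat m as @ t"
  by (induction as) (auto simp: join_Cons)

lemma join_append:
  "as \<noteq> [] \<Longrightarrow> bs \<noteq> [] \<Longrightarrow> join m (as @ bs) = join m as @ m # join m bs"
  by (induction as rule: join.induct) (auto simp: join_Cons)

lemma below_join: "(\<forall>a\<in>set as. below m a) \<Longrightarrow> below (Suc m) (join m as)"
  by (induction as rule: join.induct) (auto simp: below_def less_Suc_eq)

lemma rev_join: "rev (join m as) = join m (rev (map rev as))"
proof (induction as rule: join.induct)
  case (3 m a b as)
  then show ?case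
    using join_append[of "rev (map rev as) @ [rev b]" "[rev a]" m] by simp
qed auto

lemma ends_in_square_append: "ends_in_square v \<Longrightarrow> ends_in_square (u @ v)"
  unfolding ends_in_square_def by (metis append.assoc)

lemma append_separator_unique:
  "a @ m # u = b @ m # v \<Longrightarrow> m \<notin> set a \<Longrightarrow> m \<notin> set b \<Longrightarrow> a = b \<and> u = v"
proof (induction a arbitrary: b)
  case Nil
  then show ?case by (cases b) auto
next
  case (Cons c a)
  then show ?case by (cases b) auto
qed

lemma sepcat_unique:
  assumes "sepcat m us @ u = sepcat m vs @ v" "m \<notin> set u" "m \<notin> set v"
    "\<forall>a\<in>set us. m \<notin> set a" "\<forall>a\<in>set vs. m \<notin> set a"
  shows "us = vs \<and> u = v"
  using assms
proof (induction us arbitrary: vs)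
  case Nil
  then show ?case by (cases vs) auto
next
  case (Cons a us)
  show ?case
  proof (cases vs)
    case Nil
    with Cons.prems show ?thesis by auto
  next
    case vs: (Cons b vs')
    have eq: "a @ m # (sepcat m us @ u) = b @ m # (sepcat m vs' @ v)"
      using Cons.prems(1) vs by simp
    have "a = b \<and> sepcat m us @ u = sepcat m vs' @ v"
      using append_separator_unique[OF eq] Cons.prems(4,5) vs by auto
    with Cons vs show ?thesis by auto
  qed
qed

lemma sepcat_exists: "\<exists>us u. w = sepcat m us @ u \<and> m \<notin> set u \<and> (\<forall>a\<in>set us. m \<notin> set a)"
proof (induction w)
  case Nil
  show ?case by (rule exI[of _ "[]"]) simp
next
  case (Cons c w)
  then obtain us u where w: "w = sepcat m us @ u" "m \<notin> set u" "\<forall>a\<in>set us. m \<notin> set a"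
    by blast
  show ?case
  proof (cases "c = m")
    case True
    with w show ?thesis by (intro exI[of _ "[] # us"]) auto
  next
    case False
    show ?thesis
    proof (cases us)
      case Nil
      with w False show ?thesis by (intro exI[of _ "[]"] exI[of _ "c # u"]) auto
    next
      case (Cons a us')
      with w False show ?thesis by (intro exI[of _ "(c # a) # us'"]) auto
    qed
  qed
qed

text \<open>A square that contains the separator spans blocks \<open>x, bs, g, bs, z\<close>: it starts inside \<open>x\<close>,
  its halves meet inside \<open>g\<close>, and it ends inside \<open>z\<close>. The blocks before \<open>z\<close> are listed in \<open>h\<close>, the
  nearest one first.\<close>

definition repeats :: "'a list \<Rightarrow> ('a \<times> 'a) set" where
  "repeats h = {(g, x). \<exists>bs rest. h = bs @ g # bs @ x # rest}"

text \<open>Cut \<open>u\<close>, \<open>y\<close> and \<open>v\<close> at \<open>m\<close>. If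
  \<open>y\<close> is free of \<open>m\<close>, the square lies inside one block, which is excluded.
  Otherwise \<open>y\<close> starts with the end \<open>s\<close> of a block and ends with the
  beginning \<open>t\<close> of one; the two copies of \<open>y\<close> meet in the block
  \<open>t @ s\<close>, the first copy starts inside \<open>x\<close>, and the second ends inside
  \<open>z\<close>.\<close>

lemma join_square_cases:
  assumes "join m as = u @ y @ y @ v" "y \<noteq> []"
    and "as \<noteq> []" and free: "\<forall>a\<in>set as. m \<notin> set a" and sf: "\<forall>a\<in>set as. squarefree a"
  shows "\<exists>pre z post g x s t. as = pre @ z # post \<and> (g, x) \<in> repeats (rev pre) \<and>
    g = t @ s \<and> suffix s x \<and> prefix t z"
proof -
  obtain as0 l where as: "as = as0 @ [l]"
    using \<open>as \<noteq> []\<close> by (metis rev_exhaust)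
  obtain us u' where u: "u = sepcat m us @ u'" "m \<notin> set u'" "\<forall>a\<in>set us. m \<notin> set a"
    using sepcat_exists by blast
  obtain ys t where y: "y = sepcat m ys @ t" "m \<notin> set t" "\<forall>a\<in>set ys. m \<notin> set a"
    using sepcat_exists by blast
  obtain vs v' where v: "v = sepcat m vs @ v'" "m \<notin> set v'" "\<forall>a\<in>set vs. m \<notin> set a"
    using sepcat_exists by blast
  have eq: "sepcat m as0 @ l = u @ y @ y @ v"
    using assms(1) as by (simp add: join_snoc)
  have free': "m \<notin> set l" "\<forall>a\<in>set as0. m \<notin> set a"
    using free as by auto
  show ?thesis
  proof (cases ys)
    case Nil
    have "\<exists>a\<in>set as. \<exists>p q. a = p @ y @ y @ q"
    proof (cases vs)
      case vs: Nil
      have "sepcat m as0 @ l = sepcat m us @ (u' @ y @ y @ v')"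
        using eq u y v Nil vs by simp
      then have "l = u' @ y @ y @ v'"
        using sepcat_unique[of m as0 l us "u' @ y @ y @ v'"] free' u y v Nil by auto
      then show ?thesis using as by auto
    next
      case vs: (Cons v0 vs')
      have "sepcat m as0 @ l = sepcat m (us @ (u' @ y @ y @ v0) # vs') @ v'"
        using eq u y v Nil vs by simp
      then have "as0 = us @ (u' @ y @ y @ v0) # vs'"
        using sepcat_unique[of m as0 l "us @ (u' @ y @ y @ v0) # vs'" v'] free' u y v Nil vs by auto
      then show ?thesis using as by auto
    qed
    with sf \<open>y \<noteq> []\<close> have False by (auto simp: squarefree_def)
    then show ?thesis ..
  next
    case ys: (Cons s mid)
    define pre where "pre = us @ (u' @ s) # mid @ (t @ s) # mid"
    have m1: "(t @ s, u' @ s) \<in> repeats (rev pre)"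
      unfolding repeats_def pre_def by (simp, intro exI[of _ "rev mid"] exI[of _ "rev us"]) simp
    have free_pre: "\<forall>a\<in>set pre. m \<notin> set a"
      using u y ys unfolding pre_def by auto
    have "\<exists>z post. as = pre @ (t @ z) # post"
    proof (cases vs)
      case vs: Nil
      have "sepcat m as0 @ l = sepcat m pre @ (t @ v')"
        using eq u y v ys vs by (simp add: pre_def)
      then have "as0 = pre \<and> l = t @ v'"
        using sepcat_unique[of m as0 l pre "t @ v'"] free' free_pre y v by auto
      then show ?thesis using as by auto
    next
      case vs: (Cons v0 vs')
      have "sepcat m as0 @ l = sepcat m (pre @ (t @ v0) # vs') @ v'"
        using eq u y v ys vs by (simp add: pre_def)
      then have "as0 = pre @ (t @ v0) # vs'"
        using sepcat_unique[of m as0 l "pre @ (t @ v0) # vs'" v'] free' free_pre y v vs by auto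
      then show ?thesis using as by auto
    qed
    then obtain z post where "as = pre @ (t @ z) # post" by blast
    with m1 show ?thesis by (metis prefixI suffixI)
  qed
qed

text \<open>Used to show that a letter is blocked: \<open>t\<close> need not start an existing
  block, it is the beginning of one with a smaller letter written after it.\<close>

lemma join_ends_in_square:
  assumes "(g, x) \<in> repeats (rev pre)" "g = t @ s" "suffix s x"
  shows "ends_in_square (join m (pre @ [t]))"
proof -
  obtain bs rest where "rev pre = bs @ g # bs @ x # rest"
    using assms(1) by (auto simp: repeats_def)
  then have "pre = rev (bs @ g # bs @ x # rest)"
    by (metis rev_rev_ident)
  moreover obtain x' where "x = x' @ s"
    using assms(3) by (auto simp: suffix_def)
  ultimately have "join m (pre @ [t]) =
      (sepcat m (rev rest) @ x') @ (s @ m # sepcat m (rev bs) @ t) @ (s @ m # sepcat m (rev bs) @ t)"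
    using assms(2) join_snoc[of m pre t] by simp
  then show ?thesis
    unfolding ends_in_square_def by blast
qed

text \<open>A separator is counted as the end of the block before it, which matches the
  \<open>m\<close> appended in \<open>unblocked m z\<close>.\<close>

lemma join_position_cases:
  assumes "join m as @ [l] = x @ d # y" "as \<noteq> []"
  shows "(x = join m as \<and> d = l \<and> y = []) \<or>
    (\<exists>pre z post x' y'. as = pre @ z # post \<and> z @ [m] = x' @ d # y' \<and> x = sepcat m pre @ x')"
  using assms
proof (induction as arbitrary: x rule: join.induct)
  case (2 m a)
  show ?case
  proof (cases y rule: rev_cases)
    case Nil
    with 2 show ?thesis by auto
  next
    case (snoc y' e)
    with 2 have "a = x @ d # y'" by auto
    then have "a @ [m] = x @ d # (y' @ [m])" by simp
    then show ?thesis
      by (metis append_Nil sepcat_simps(1))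
  qed
next
  case (3 m a b as)
  have eq: "(a @ [m]) @ (join m (b # as) @ [l]) = x @ d # y"
    using 3 by simp
  show ?case
  proof (cases "length x < length (a @ [m])")
    case True
    then obtain y' where "a @ [m] = x @ d # y'"
      using eq by (auto simp: append_eq_append_conv2 Cons_eq_append_conv append_eq_Cons_conv)
    then show ?thesis
      by (metis append_Nil sepcat_simps(1))
  next
    case False
    then obtain x' where x': "x = (a @ [m]) @ x'" "join m (b # as) @ [l] = x' @ d # y"
      using eq by (auto simp: append_eq_append_conv2 Cons_eq_append_conv append_eq_Cons_conv)
    from 3(1)[OF x'(2)] have "(x' = join m (b # as) \<and> d = l \<and> y = []) \<or>
      (\<exists>pre z post x'' y'. b # as = pre @ z # post \<and> z @ [m] = x'' @ d # y' \<and> x' = sepcat m pre @ x'')"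
      by simp
    then show ?thesis
    proof (elim disjE exE conjE)
      assume "x' = join m (b # as)" "d = l" "y = []"
      then show ?thesis using x' by simp
    next
      fix pre z post x'' y'
      assume "b # as = pre @ z # post" "z @ [m] = x'' @ d # y'" "x' = sepcat m pre @ x''"
      then show ?thesis
        using x' by (intro disjI2 exI[of _ "a # pre"] exI[of _ z] exI[of _ post] exI[of _ x'']
            exI[of _ y']) auto
    qed
  qed
qed simp

lemma unblockedI:
  "w @ [m] = x @ d # y \<Longrightarrow> c < d \<Longrightarrow> \<not> ends_in_square (x @ [c]) \<Longrightarrow> (length x, c) \<in> unblocked m w"
proof -
  assume a: "w @ [m] = x @ d # y" "c < d" "\<not> ends_in_square (x @ [c])"
  have "length (w @ [m]) = length (x @ d # y)" using a(1) by simp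
  then have l: "length x \<le> length w" by simp
  have "take (length x) (w @ [m]) = x" using a(1) by simp
  then have "take (length x) w = x" using l by simp
  moreover have "(w @ [m]) ! length x = d" using a(1) by simp
  ultimately show ?thesis using a l by (auto simp: unblocked_def)
qed

lemma unblockedE:
  assumes "(q, c) \<in> unblocked m w"
  obtains x d y where "w @ [m] = x @ d # y" "c < d" "\<not> ends_in_square (x @ [c])" "q = length x"
proof -
  have q: "q < length (w @ [m])" and c: "c < (w @ [m]) ! q" "\<not> ends_in_square (take q w @ [c])"
    using assms by (auto simp: unblocked_def)
  have "w @ [m] = take q (w @ [m]) @ (w @ [m]) ! q # drop (Suc q) (w @ [m])"
    using q by (rule id_take_nth_drop)
  moreover have "take q (w @ [m]) = take q w" "length (take q w) = q" using q by auto
  ultimately show ?thesis using that c by metis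
qed

text \<open>A square at the end of a prefix of a block persists in the joined word, so joining
  creates no new exceptions inside blocks. The one new candidate is the letter \<open>m\<close>
  after the last block, where the bound rises from \<open>m\<close> to \<open>Suc m\<close>; smaller
  letters there are inherited from the last block.\<close>

lemma unblocked_join_cases:
  assumes "(q, c) \<in> unblocked (Suc m) (join m as)" "as \<noteq> []"
  shows "(q = length (join m as) \<and> c = m \<and> \<not> ends_in_square (join m as @ [m])) \<or>
    (\<exists>pre z post q'. as = pre @ z # post \<and> (q', c) \<in> unblocked m z \<and>
       q = length (sepcat m pre) + q' \<and> \<not> ends_in_square (sepcat m pre @ take q' z @ [c]))"
proof -
  from assms(1) obtain x d y where x: "join m as @ [Suc m] = x @ d # y" "c < d"
    "\<not> ends_in_square (x @ [c])" "q = length x"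
    by (rule unblockedE)
  consider (last) "x = join m as" "d = Suc m"
    | (inner) pre z post x' y' where "as = pre @ z # post" "z @ [m] = x' @ d # y'"
        "x = sepcat m pre @ x'"
    using join_position_cases[OF x(1) assms(2)] by blast
  then show ?thesis
  proof cases
    case last
    show ?thesis
    proof (cases "c = m")
      case True
      with x last show ?thesis by simp
    next
      case False
      obtain pre z where as: "as = pre @ [z]" using assms(2) by (metis rev_exhaust)
      then have xz: "x = sepcat m pre @ z" using last by (simp add: join_snoc)
      have "\<not> ends_in_square (z @ [c])"
        using x(3) xz ends_in_square_append[of "z @ [c]" "sepcat m pre"] by auto
      then have "(length z, c) \<in> unblocked m z"
        using unblockedI[of z m z m "[]" c] False x(2) last by simp
      with as xz x show ?thesis
        by (intro disjI2 exI[of _ pre] exI[of _ z] exI[of _ "[]"] exI[of _ "length z"]) auto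
    qed
  next
    case inner
    have "\<not> ends_in_square (x' @ [c])"
      using x(3) inner ends_in_square_append[of "x' @ [c]" "sepcat m pre"] by auto
    with inner x have "(length x', c) \<in> unblocked m z"
      by (intro unblockedI)
    moreover have "take (length x') z = x'"
    proof -
      have "length x' \<le> length z" using arg_cong[OF inner(2), of length] by simp
      moreover have "take (length x') (z @ [m]) = x'" using inner(2) by simp
      ultimately show ?thesis by simp
    qed
    ultimately show ?thesis
      using inner x by (intro disjI2 exI[of _ pre] exI[of _ z] exI[of _ post]
          exI[of _ "length x'"]) auto
  qed
qed

section \<open>Squares and blocked letters of joined words\<close>

text \<open>The letter in the result comes from the second word; \<open>m\<close> marks its end.\<close>

fun first_diff :: "nat \<Rightarrow> nat list \<Rightarrow> nat list \<Rightarrow> nat \<times> nat" where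
  "first_diff m (a # u) (b # v) = (if a = b then map_prod Suc id (first_diff m u v) else (0, b))"
| "first_diff m [] (b # v) = (0, b)"
| "first_diff m u [] = (0, m)"

lemma first_diff_self [simp]: "first_diff m u u = (length u, m)"
  by (induction u) auto

lemma first_diff_prefix_left: "first_diff m u (u @ b # v) = (length u, b)"
  by (induction u) auto

lemma first_diff_prefix_right: "first_diff m (u @ v) u = (length u, m)"
proof (induction u)
  case Nil
  then show ?case by (cases v) auto
qed auto

lemma first_diff_common: "first_diff m (x @ u) (x @ v) =
    map_prod ((+) (length x)) id (first_diff m u v)"
  by (induction x) (auto simp: map_prod_def split: prod.splits)

lemma first_diff_cases:
  obtains (eq) "u = v" "first_diff m u v = (length u, m)"
    | (left) b v' where "v = u @ b # v'" "first_diff m u v = (length u, b)"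
    | (right) b u' where "u = v @ b # u'" "first_diff m u v = (length v, m)"
    | (differ) x a b u' v' where "u = x @ a # u'" "v = x @ b # v'" "a \<noteq> b"
        "first_diff m u v = (length x, b)"
proof -
  have "u = v \<or> (\<exists>b v'. v = u @ b # v') \<or> (\<exists>b u'. u = v @ b # u') \<or>
    (\<exists>x a b u' v'. u = x @ a # u' \<and> v = x @ b # v' \<and> a \<noteq> b)"
  proof (induction u arbitrary: v)
    case Nil
    then show ?case by (cases v) auto
  next
    case (Cons a u)
    show ?case
    proof (cases v)
      case Nil
      then show ?thesis by auto
    next
      case v: (Cons b w)
      show ?thesis
      proof (cases "a = b")
        case True
        then show ?thesis using Cons[of w] v by (metis append_Cons)
      next
        case False
        then show ?thesis using v by (metis append_Nil)
      qed
    qed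
  qed
  then show ?thesis
  proof (elim disjE exE conjE)
    fix x a b u' v' assume "u = x @ a # u'" "v = x @ b # v'" "a \<noteq> b"
    then show ?thesis by (intro differ[of x a u' b v']) (auto simp: first_diff_common)
  next
    fix b u' assume "u = v @ b # u'"
    then show ?thesis by (intro right[of b u']) (auto simp: first_diff_prefix_right)
  qed (auto intro: eq left simp: first_diff_prefix_left)
qed

lemma first_diff_common_prefix_le: "prefix t u \<Longrightarrow> prefix t v \<Longrightarrow> length t \<le> fst (first_diff m u v)"
proof (induction t arbitrary: u v)
  case (Cons c t)
  then obtain u' v' where "u = c # u'" "v = c # v'" by (auto simp: prefix_def)
  with Cons show ?case by auto
qed simp

lemma first_diff_take: "take (fst (first_diff m u v)) u = take (fst (first_diff m u v)) v"
  by (induction m u v rule: first_diff.induct) auto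

lemma first_diff_next_letter:
  "first_diff m u v = (q, c) \<Longrightarrow> c \<noteq> m \<Longrightarrow> \<exists>s. v = take q u @ c # s \<and> q \<le> length u"
  by (cases rule: first_diff_cases[of u v m]) auto

lemma suffix_drop_first_diff:
  assumes "length g \<le> k + fst (first_diff m (rev g) (rev x))"
  shows "suffix (drop k g) x"
proof -
  define l where "l = fst (first_diff m (rev g) (rev x))"
  have "take l (rev g) = take l (rev x)"
    unfolding l_def by (rule first_diff_take)
  then have "drop (length g - l) g = drop (length x - l) x"
    by (simp add: take_rev)
  moreover have "suffix (drop k g) (drop (length g - l) g)"
    using assms unfolding l_def[symmetric]
    by (metis drop_drop le_add_diff_inverse2 le_diff_conv suffix_drop)
  ultimately show ?thesis
    by (metis suffix_drop suffix_order.trans)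
qed

section \<open>Enumeration of the repeated block sequences in a history\<close>

fun agree :: "'a list \<Rightarrow> 'a list \<Rightarrow> 'a list \<Rightarrow> bool" where
  "agree [] r t = True"
| "agree (a # n) (b # r) (c # t) = (if b = c then agree n r t else False)"
| "agree (a # n) [] t = False"
| "agree (a # n) r [] = False"

text \<open>The list \<open>n\<close> is a unary counter for the length of \<open>bs\<close>. In the
  history \<open>h\<close>, the third argument starts at the candidate \<open>g\<close> and advances
  by one block per round; the fourth starts at \<open>x\<close> and advances by two, because
  \<open>x\<close> lies at distance \<open>2 * length bs + 1\<close> from the front.\<close>

fun repeat_list_from :: "'a list \<Rightarrow> 'a list \<Rightarrow> 'a list \<Rightarrow> 'a list \<Rightarrow> ('a \<times> 'a) list" where
  "repeat_list_from n h (g # t) (x # f) =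
     (let r = (case f of [] \<Rightarrow> [] | y # f' \<Rightarrow> repeat_list_from (g # n) h t f') in if agree n h t then
         (g, x) # r else r)"
| "repeat_list_from n h t f = []"

abbreviation repeat_list :: "'a list \<Rightarrow> ('a \<times> 'a) list" where
  "repeat_list h \<equiv> repeat_list_from [] h h (tl h)"

lemma agree_append: "length n = length bs \<Longrightarrow> agree n (bs @ r) t \<longleftrightarrow> (\<exists>t'. t = bs @ t')"
proof (induction bs arbitrary: n t)
  case (Cons b bs)
  then obtain a n' where "n = a # n'" "length n' = length bs" by (cases n) auto
  then show ?case using Cons.IH[of n'] by (cases t) auto
qed simp

lemma set_repeat_list_from:
  assumes "h = bs @ t" "length n = length bs" "f = drop (Suc (length bs)) t"
  shows "set (repeat_list_from n h t f) = {(g, x). \<exists>cs rest. h = cs @ g # cs @ x # rest \<and>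
      length bs \<le> length cs}"
  using assms
proof (induction n h t f arbitrary: bs rule: repeat_list_from.induct)
  case (1 n h g t x f)
  define b2 where "b2 = take (length bs) t"
  have d: "drop (length bs) t = x # f" using 1(4) by simp
  have split: "t = b2 @ x # f"
    unfolding b2_def d[symmetric] by simp
  have len: "length b2 = length bs"
    using arg_cong[OF d, of length] by (simp add: b2_def)
  have IH: "set (case f of [] \<Rightarrow> [] | y # f' \<Rightarrow> repeat_list_from (g # n) h t f') =
      {(g', x). \<exists>cs rest. h = cs @ g' # cs @ x # rest \<and> Suc (length bs) \<le> length cs}"
  proof (cases f)
    case Nil
    have "length h = 2 * length bs + 2"
      using 1(2) split len Nil by simp
    then have "False" if "h = cs @ g' # cs @ x' # rest" "Suc (length bs) \<le> length cs" for cs g' x' rest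
      using that by simp
    then show ?thesis using Nil by auto
  next
    case (Cons y f')
    have "f' = drop (Suc (length (bs @ [g]))) t"
      using split len Cons by simp
    then show ?thesis
      using 1(1)[OF Cons, of "bs @ [g]"] 1(2,3) Cons by simp
  qed
  have agree: "agree n h t \<longleftrightarrow> (\<exists>rest. t = bs @ x # rest)"
    using agree_append[of n bs "g # t" t] 1(2,3) split len by auto
  have unique: "x' = x" if "t = bs @ x' # rest" for x' rest
    using that split len by auto
  have low: "(\<exists>cs rest. h = cs @ g' # cs @ x' # rest \<and> length cs = length bs) \<longleftrightarrow>
      g' = g \<and> x' = x \<and> agree n h t" for g' x'
  proof
    assume "\<exists>cs rest. h = cs @ g' # cs @ x' # rest \<and> length cs = length bs"
    then obtain cs rest where "bs @ g # t = cs @ g' # cs @ x' # rest" "length cs = length bs"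
      using 1(2) by metis
    then have "cs = bs \<and> g # t = g' # cs @ x' # rest"
      by (metis append_eq_append_conv)
    then have "g' = g" "t = bs @ x' # rest" by simp_all
    with agree unique show "g' = g \<and> x' = x \<and> agree n h t" by blast
  next
    assume "g' = g \<and> x' = x \<and> agree n h t"
    with agree obtain rest where "t = bs @ x # rest" "g' = g" "x' = x" by blast
    with 1(2) have "h = bs @ g' # bs @ x' # rest" by simp
    then show "\<exists>cs rest. h = cs @ g' # cs @ x' # rest \<and> length cs = length bs" by blast
  qed
  have "{(g', x'). \<exists>cs rest. h = cs @ g' # cs @ x' # rest \<and> length bs \<le> length cs} =
      {(g', x'). g' = g \<and> x' = x \<and> agree n h t} \<union>
      {(g', x'). \<exists>cs rest. h = cs @ g' # cs @ x' # rest \<and> Suc (length bs) \<le> length cs}"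
    unfolding low[symmetric] by (auto simp: Suc_le_eq le_less)
  then show ?case
    unfolding repeat_list_from.simps Let_def IH[symmetric] by (auto simp only: set_append list.set
        split: if_split)
next
  case ("2_1" n h f)
  then show ?case by auto
next
  case ("2_2" n h t)
  have "length h \<le> 2 * length bs + 1"
    using "2_2" by simp
  then have "False" if "h = cs @ g' # cs @ x' # rest" "length bs \<le> length cs" for cs g' x' rest
    using that by simp
  then show ?case by auto
qed

lemma set_repeat_list: "set (repeat_list h) = repeats h"
  using set_repeat_list_from[of h "[]" h "[]" "tl h"] by (simp add: repeats_def drop_Suc)

text \<open>Lengths of blocks, \<^const>\<open>first_diff\<close> of two blocks and of the two reversed blocks, and a list
  containing all unblocked pairs.\<close>

type_synonym 'a data = "('a \<Rightarrow> nat) \<times> ('a \<Rightarrow> 'a \<Rightarrow> nat \<times> nat) \<times> ('a \<Rightarrow> 'a \<Rightarrow> nat \<times> nat)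
    \<times> ('a \<Rightarrow> (nat \<times> nat) list)"

fun no_square :: "'a data \<Rightarrow> 'a list \<Rightarrow> 'a list \<Rightarrow> bool" where
  "no_square (l, p, u, e) h [] = True"
| "no_square (l, p, u, e) h (z # s) =
     ((\<forall>(g, x)\<in>set (repeat_list h). fst (u x g) + fst (p g z) < l g) \<and> no_square (l, p, u, e)
         (z # h) s)"

text \<open>The offset \<open>k\<close> counts a separator after every block, hence
  \<open>k - 1\<close> at the end of the word. The test \<open>c < m\<close> excludes the marker for
  the end of \<open>g\<close>. After the last block, the letter \<open>m\<close> is blocked when all
  of \<open>g\<close> is a suffix of \<open>x\<close>.\<close>

fun exceptions :: "'a data \<Rightarrow> nat \<Rightarrow> nat \<Rightarrow> 'a list \<Rightarrow> 'a list \<Rightarrow> (nat \<times> nat) list" where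
  "exceptions (l, p, u, e) m k h [] =
     (if \<exists>(g, x)\<in>set (repeat_list h). l g \<le> fst (u g x) then [] else [(k - 1, m)])"
| "exceptions (l, p, u, e) m k h (z # s) =
     map (\<lambda>(q, c). (k + q, c))
       (filter (\<lambda>(q, c). \<not> (\<exists>(g, x)\<in>set (repeat_list h). p z g = (q, c) \<and> c < m \<and>
           l g \<le> Suc q + fst (u g x))) (e z))
     @ exceptions (l, p, u, e) m (k + Suc (l z)) (z # h) s"

text \<open>Injectivity makes equality of blocks the same as equality of their names, so repeats can
  be searched among names.\<close>

definition describes :: "nat \<Rightarrow> ('a \<Rightarrow> nat list) \<Rightarrow> 'a set \<Rightarrow> 'a data \<Rightarrow> bool" where
  "describes m w A = (\<lambda>(l, p, u, e). inj_on w A \<and>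
     (\<forall>a\<in>A. below m (w a) \<and> squarefree (w a) \<and> l a = length (w a) \<and> unblocked m (w a) \<subseteq> set (e a)) \<and>
     (\<forall>a\<in>A. \<forall>b\<in>A. p a b = first_diff m (w a) (w b) \<and> u a b = first_diff m (rev (w a)) (rev (w b))))"

lemma no_square_iff:
  "no_square (l, p, u, e) h s \<longleftrightarrow>
    (\<forall>pre z post. s = pre @ z # post \<longrightarrow> (\<forall>(g, x)\<in>repeats (rev pre @ h). fst (u x g) + fst (p g z) < l
        g))"
proof (induction s arbitrary: h)
  case (Cons a s)
  have "(\<forall>pre z post. a # s = pre @ z # post \<longrightarrow> P (rev pre @ h) z) \<longleftrightarrow>
      P h a \<and> (\<forall>pre z post. s = pre @ z # post \<longrightarrow> P (rev pre @ a # h) z)" for P :: "'a list \<Rightarrow> 'a \<Rightarrow> bool"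
    by (simp add: Cons_eq_append_conv) (metis append_Cons append_Nil append.assoc rev.simps(2))
  from this[of "\<lambda>h z. \<forall>(g, x)\<in>repeats h. fst (u x g) + fst (p g z) < l g"] show ?case
    using Cons by (simp add: set_repeat_list)
qed simp

lemma exceptions_iff:
  "(q, c) \<in> set (exceptions (l, p, u, e) m k h s) \<longleftrightarrow>
    ((q, c) = (k + sum_list (map (\<lambda>a. Suc (l a)) s) - 1, m) \<and> \<not> (\<exists>(g, x)\<in>repeats (rev s @ h). l g \<le>
        fst (u g x))) \<or>
    (\<exists>pre z post q'. s = pre @ z # post \<and> (q', c) \<in> set (e z) \<and> q =
        k + sum_list (map (\<lambda>a. Suc (l a)) pre) + q' \<and>
       \<not> (\<exists>(g, x)\<in>repeats (rev pre @ h). p z g = (q', c) \<and> c < m \<and> l g \<le> Suc q' + fst (u g x)))"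
proof (induction s arbitrary: h k)
  case Nil
  then show ?case by (auto simp: set_repeat_list)
next
  case (Cons a s)
  have split: "(\<exists>pre z post q'. a # s = pre @ z # post \<and> P q' pre z) \<longleftrightarrow>
      (\<exists>q'. P q' [] a) \<or> (\<exists>pre z post q'. s = pre @ z # post \<and> P q' (a # pre) z)"
    for P :: "nat \<Rightarrow> 'a list \<Rightarrow> 'a \<Rightarrow> bool"
    by (auto simp: Cons_eq_append_conv)
  show ?case
    unfolding exceptions.simps set_append Un_iff Cons split
    by (auto simp: set_repeat_list add.assoc)
qed

lemma repeats_map_inj:
  assumes "(g', x') \<in> repeats (map w h)" "inj_on w A" "set h \<subseteq> A"
  shows "\<exists>g x. (g, x) \<in> repeats h \<and> g' = w g \<and> x' = w x"
proof -
  obtain bs rest where "map w h = bs @ (g' # bs @ x' # rest)"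
    using assms(1) by (auto simp: repeats_def)
  from map_eq_append_conv[THEN iffD1, OF this]
  obtain b1 h1 where 1: "h = b1 @ h1" "map w b1 = bs" "map w h1 = g' # bs @ x' # rest"
    by auto
  from map_eq_Cons_conv[THEN iffD1, OF 1(3)]
  obtain g h2 where 2: "h1 = g # h2" "w g = g'" "map w h2 = bs @ (x' # rest)"
    by auto
  from map_eq_append_conv[THEN iffD1, OF 2(3)]
  obtain b2 h3 where 3: "h2 = b2 @ h3" "map w b2 = bs" "map w h3 = x' # rest"
    by auto
  from map_eq_Cons_conv[THEN iffD1, OF 3(3)]
  obtain x r where 4: "h3 = x # r" "w x = x'"
    by auto
  have h: "h = b1 @ g # b2 @ x # r" "map w b1 = bs" "map w b2 = bs" "w g = g'" "w x = x'"
    using 1 2 3 4 by auto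
  then have "b1 = b2"
    using assms(2,3) by (intro inj_on_map_eq_map[THEN iffD1, of w b1 b2]) (auto intro: inj_on_subset)
  with h show ?thesis
    unfolding repeats_def by auto
qed

lemma repeats_map: "(g, x) \<in> repeats h \<Longrightarrow> (w g, w x) \<in> repeats (map w h)"
  unfolding repeats_def by fastforce

lemma repeats_subset: "(g, x) \<in> repeats h \<Longrightarrow> g \<in> set h \<and> x \<in> set h"
  unfolding repeats_def by auto

lemma length_sepcat: "length (sepcat m as) = sum_list (map (\<lambda>a. Suc (length a)) as)"
  by (induction as) auto

lemma length_join: "as \<noteq> [] \<Longrightarrow> length (join m as) = sum_list (map (\<lambda>a. Suc (length a)) as) - 1"
  by (induction m as rule: join.induct) auto

theorem squarefree_join:
  assumes d: "describes m w A (l, p, u, e)" and s: "set s \<subseteq> A" "s \<noteq> []"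
    and ok: "no_square (l, p, u, e) [] s"
  shows "squarefree (join m (map w s))"
  unfolding squarefree_def
proof (intro allI impI)
  fix x y v assume eq: "join m (map w s) = x @ y @ y @ v"
  show "y = []"
  proof (rule ccontr)
    assume y: "y \<noteq> []"
    have "\<forall>a\<in>set (map w s). m \<notin> set a" "\<forall>a\<in>set (map w s). squarefree a"
      using d s by (auto simp: describes_def intro!: below_not_in)
    from join_square_cases[OF eq y _ this] s obtain pre' z' post' g' x' s' t' where
      1: "map w s = pre' @ z' # post'" "(g', x') \<in> repeats (rev pre')" "g' = t' @ s'" "suffix s' x'"
          "prefix t' z'"
      by auto
    then obtain pre z post where 2: "s = pre @ z # post" "pre' = map w pre" "z' = w z"
      by (auto simp: map_eq_append_conv map_eq_Cons_conv)
    have "inj_on w A" "set (rev pre) \<subseteq> A"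
      using d s 2 by (auto simp: describes_def)
    then obtain g x where 3: "(g, x) \<in> repeats (rev pre)" "g' = w g" "x' = w x"
      using repeats_map_inj[of g' x' w "rev pre" A] 1 2 by (auto simp: rev_map)
    then have A: "g \<in> A" "x \<in> A" "z \<in> A"
      using repeats_subset[OF 3(1)] 2 s by auto
    have "fst (u x g) + fst (p g z) < l g"
      using ok 2 3 unfolding no_square_iff by fastforce
    moreover have "length s' \<le> fst (u x g)"
      using first_diff_common_prefix_le[of "rev s'" "rev (w x)" "rev (w g)" m] 1 3 A d
      by (auto simp: describes_def suffix_to_prefix[symmetric] suffix_def)
    moreover have "length t' \<le> fst (p g z)"
      using first_diff_common_prefix_le[of t' "w g" "w z" m] 1 2 3 A d
      by (auto simp: describes_def)
    moreover have "l g = length t' + length s'"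
      using 1 3 A d by (auto simp: describes_def)
    ultimately show False by simp
  qed
qed

theorem unblocked_join:
  assumes d: "describes m w A (l, p, u, e)" and s: "set s \<subseteq> A" "s \<noteq> []"
  shows "unblocked (Suc m) (join m (map w s)) \<subseteq> set (exceptions (l, p, u, e) m 0 [] s)"
proof (rule subrelI)
  fix q c assume "(q, c) \<in> unblocked (Suc m) (join m (map w s))"
  then consider
    (last) "q = length (join m (map w s))" "c = m" "\<not> ends_in_square (join m (map w s) @ [m])"
    | (inner) pre' z' post' q' where "map w s = pre' @ z' # post'" "(q', c) \<in> unblocked m z'"
       "q = length (sepcat m pre') + q'" "\<not> ends_in_square (sepcat m pre' @ take q' z' @ [c])"
    using unblocked_join_cases[of q c m "map w s"] s by auto
  then show "(q, c) \<in> set (exceptions (l, p, u, e) m 0 [] s)"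
  proof cases
    case last
    have "map (\<lambda>a. Suc (length a)) (map w s) = map (\<lambda>a. Suc (l a)) s"
      using d s by (auto simp: describes_def)
    then have len: "length (join m (map w s)) = sum_list (map (\<lambda>a. Suc (l a)) s) - 1"
      using s by (metis length_join map_is_Nil_conv)
    have "\<not> l g \<le> fst (u g x)" if "(g, x) \<in> repeats (rev s)" for g x
    proof
      assume le: "l g \<le> fst (u g x)"
      have "g \<in> A" "x \<in> A" using repeats_subset[OF that] s by auto
      then have "suffix (w g) (w x)"
        using suffix_drop_first_diff[of "w g" 0 m "w x"] le d by (auto simp: describes_def)
      \<comment> \<open>The letter \<open>m\<close> after the last block opens an empty block, so
        the part of \<open>g\<close> in \<open>z\<close> is empty and \<open>s\<close> is all of
        \<open>g\<close>.\<close>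
      then have "ends_in_square (join m (map w s @ [[]]))"
        using join_ends_in_square[of "w g" "w x" "map w s" "[]" "w g" m] repeats_map[OF that, of w]
        by (simp add: rev_map)
      moreover have "join m (map w s @ [[]]) = join m (map w s) @ [m]"
        using s by (simp add: join_append)
      ultimately show False using last by simp
    qed
    then show ?thesis
      unfolding exceptions_iff using last len by auto
  next
    case inner
    then obtain pre z post where 2: "s = pre @ z # post" "pre' = map w pre" "z' = w z"
      by (auto simp: map_eq_append_conv map_eq_Cons_conv)
    have "map (\<lambda>a. Suc (length a)) (map w pre) = map (\<lambda>a. Suc (l a)) pre"
      using d s 2 by (auto simp: describes_def)
    then have len: "length (sepcat m (map w pre)) = sum_list (map (\<lambda>a. Suc (l a)) pre)"
      by (metis length_sepcat)
    have z: "z \<in> A" using 2 s by auto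
    have "\<not> (p z g = (q', c) \<and> c < m \<and> l g \<le> Suc q' + fst (u g x))"
        if "(g, x) \<in> repeats (rev pre)" for g x
    proof
      assume a: "p z g = (q', c) \<and> c < m \<and> l g \<le> Suc q' + fst (u g x)"
      have A: "g \<in> A" "x \<in> A" using repeats_subset[OF that] s 2 by auto
      have "first_diff m (w z) (w g) = (q', c)" "c \<noteq> m"
        using a A z d by (auto simp: describes_def)
      then obtain r where r: "w g = take q' (w z) @ c # r" "q' \<le> length (w z)"
        using first_diff_next_letter by blast
      have "suffix (drop (Suc q') (w g)) (w x)"
        using a A d by (intro suffix_drop_first_diff[of _ _ m]) (auto simp: describes_def)
      then have "suffix r (w x)" using r by simp
      then have "ends_in_square (join m (map w pre @ [take q' (w z) @ [c]]))"
        using join_ends_in_square[of "w g" "w x" "map w pre" "take q' (w z) @ [c]" r m]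
            repeats_map[OF that, of w] r
        by (simp add: rev_map)
      then show False using inner 2 by (simp add: join_snoc)
    qed
    moreover have "(q', c) \<in> set (e z)"
      using inner 2 z d by (auto simp: describes_def)
    ultimately show ?thesis
      unfolding exceptions_iff using inner 2 len
      by (intro disjI2 exI[of _ pre] exI[of _ z] exI[of _ post] exI[of _ q']) auto
  qed
qed

section \<open>Tables of common prefix lengths\<close>

text \<open>Distinct blocks decide the comparison even if one is a prefix of the other, since the
  separator \<open>m\<close> differs from every letter of a block. If \<open>b\<close> ends first
  and is not the last block, its end marker \<open>m\<close> is already the true next letter and
  \<open>p a b\<close> is passed on unchanged; if it is last, the marker becomes
  \<open>Suc m\<close>.\<close>

fun first_diff_seq :: "nat \<Rightarrow> ('a \<Rightarrow> nat) \<Rightarrow> ('a \<Rightarrow> 'a \<Rightarrow> nat \<times> nat) \<Rightarrow> 'a list \<Rightarrow> 'a list \<Rightarrow> nat \<times> nat" where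
  "first_diff_seq m l p (a # a' # s) (b # b' # t) =
     (if a = b then map_prod ((+) (Suc (l a))) id (first_diff_seq m l p (a' # s) (b' # t)) else p a b)"
| "first_diff_seq m l p (a # a' # s) [b] =
     (if a = b then (l a, Suc m) else if snd (p a b) = m then (fst (p a b), Suc m) else p a b)"
| "first_diff_seq m l p [a] (b # b' # t) = (if a = b then (l a, m) else p a b)"
| "first_diff_seq m l p [a] [b] =
     (if a = b then (l a, Suc m) else if snd (p a b) = m then (fst (p a b), Suc m) else p a b)"

lemma first_diff_append:
  assumes "below m u" "below m v" "u \<noteq> v" "xs = [] \<or> (\<exists>xs'. xs = m # xs')"
    and "ys = [] \<and> n = m' \<or> (\<exists>ys'. ys = m # ys') \<and> n = m"
  shows "first_diff m' (u @ xs) (v @ ys) =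
    (if snd (first_diff m u v) = m then (fst (first_diff m u v), n) else first_diff m u v)"
proof (cases rule: first_diff_cases[of u v m])
  case (left b v')
  then have "b < m" using assms by (auto simp: below_def)
  with left assms(4) show ?thesis
    by (auto simp: first_diff_prefix_left first_diff_common)
next
  case (right b u')
  then have "b < m" using assms by (auto simp: below_def)
  with right assms(5) show ?thesis
    by (auto simp: first_diff_prefix_right first_diff_common)
next
  case (differ x a b u' v')
  then have "b < m" using assms by (auto simp: below_def)
  with differ show ?thesis by (simp add: first_diff_common)
qed (use assms in simp)

lemma first_diff_join:
  assumes "inj_on w A" "\<forall>a\<in>A. below m (w a) \<and> l a = length (w a)" "\<forall>a\<in>A. \<forall>b\<in>A.
      p a b = first_diff m (w a) (w b)"
    and "set s \<subseteq> A" "set t \<subseteq> A" "s \<noteq> []" "t \<noteq> []"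
  shows "first_diff (Suc m) (join m (map w s)) (join m (map w t)) = first_diff_seq m l p s t"
  using assms(4-)
proof (induction s arbitrary: t)
  case (Cons a s)
  obtain b t' where t: "t = b # t'" using Cons.prems by (cases t) auto
  have ab: "a \<in> A" "b \<in> A" using Cons.prems t by auto
  have wab: "below m (w a)" "below m (w b)" "l a = length (w a)" "p a b = first_diff m (w a) (w b)"
    using assms ab by auto
  show ?case
  proof (cases "a = b")
    case True
    consider "s = []" "t' = []" | b' t'' where "s = []" "t' = b' # t''" | a' s' where "s = a' # s'"
        "t' = []"
      | a' s' b' t'' where "s = a' # s'" "t' = b' # t''"
      by (cases s; cases t') auto
    then show ?thesis
    proof cases
      case 4
      have "first_diff (Suc m) (join m (map w s)) (join m (map w t')) = first_diff_seq m l p s t'"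
        using Cons.IH[of t'] Cons.prems 4 t by auto
      then show ?thesis using 4 True t wab
        by (auto simp: first_diff_common prod.map_comp comp_def map_prod_def split: prod.splits)
    qed (use True t wab in \<open>auto simp: first_diff_prefix_left first_diff_prefix_right\<close>)
  next
    case False
    then have ne: "w a \<noteq> w b" using assms(1) ab by (auto simp: inj_on_def)
    define xs where "xs = (if s = [] then [] else m # join m (map w s))"
    define ys where "ys = (if t' = [] then [] else m # join m (map w t'))"
    define n where "n = (if t' = [] then Suc m else m)"
    have x: "join m (map w (a # s)) = w a @ xs"
      unfolding xs_def by (simp add: join_Cons)
    have y: "join m (map w t) = w b @ ys"
      unfolding ys_def t by (simp add: join_Cons)
    have "first_diff (Suc m) (w a @ xs) (w b @ ys) =
        (if snd (first_diff m (w a) (w b)) = m then (fst (first_diff m (w a) (w b)), n) else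
            first_diff m (w a) (w b))"
      using wab ne by (intro first_diff_append) (auto simp: xs_def ys_def n_def)
    then show ?thesis
      unfolding x y using False t wab(4)
      by (cases s; cases t') (auto simp: n_def prod_eq_iff)
  qed
qed simp

type_synonym table = "nat list \<times> (nat \<times> nat) list list \<times> (nat \<times> nat) list list \<times> (nat \<times> nat) list list"

text \<open>A copy of \<open>!\<close> without its default simp rules, so that evaluation uses only
  the one-step rules stated for it.\<close>

definition lookup :: "'a list \<Rightarrow> nat \<Rightarrow> 'a" where "lookup xs i = xs ! i"
definition lookup2 :: "'a list list \<Rightarrow> nat \<Rightarrow> nat \<Rightarrow> 'a" where "lookup2 xs i j = xs ! i ! j"

fun table_data :: "table \<Rightarrow> nat data" where
  "table_data (l, p, u, e) = (lookup l, lookup2 p, lookup2 u, lookup e)"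

fun differ :: "nat list \<Rightarrow> nat list \<Rightarrow> bool" where
  "differ (a # s) (b # t) = (if a = b then differ s t else True)"
| "differ [] [] = False"
| "differ [] (b # t) = True"
| "differ (a # s) [] = True"

fun all_differ :: "nat list list \<Rightarrow> bool" where
  "all_differ [] = True"
| "all_differ (s # S) = (list_all (differ s) S \<and> all_differ S)"

fun bounded :: "nat \<Rightarrow> nat list \<Rightarrow> bool" where
  "bounded n [] = True"
| "bounded n (a # s) = (a < n \<and> bounded n s)"

fun seq_length :: "(nat \<Rightarrow> nat) \<Rightarrow> nat list \<Rightarrow> nat" where
  "seq_length l [] = 0"
| "seq_length l (a # s) = Suc (l a) + seq_length l s"

fun step :: "nat \<Rightarrow> nat list list \<Rightarrow> table \<Rightarrow> table" where
  "step m S (l, p, u, e) =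
    (map (\<lambda>s. seq_length (lookup l) s - 1) S,
     map (\<lambda>s. map (first_diff_seq m (lookup l) (lookup2 p) s) S) S,
     (let R = map rev S in map (\<lambda>s. map (first_diff_seq m (lookup l) (lookup2 u) s) R) R),
     map (exceptions (lookup l, lookup2 p, lookup2 u, lookup e) m 0 []) S)"

fun step_ok :: "nat \<Rightarrow> nat list list \<Rightarrow> table \<Rightarrow> bool" where
  "step_ok n S T = (all_differ S \<and> list_all (\<lambda>s. s \<noteq> [] \<and> bounded n s \<and>
      no_square (table_data T) [] s) S)"

definition next_words :: "nat \<Rightarrow> nat list list \<Rightarrow> nat list list \<Rightarrow> nat list list" where
  "next_words m S ws = map (\<lambda>s. join m (map (lookup ws) s)) S"

definition represents :: "nat \<Rightarrow> nat list list \<Rightarrow> table \<Rightarrow> bool" where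
  "represents m ws T \<longleftrightarrow> describes m (lookup ws) {..<length ws} (table_data T)"

lemma differ_iff: "differ s t \<longleftrightarrow> s \<noteq> t"
  by (induction s t rule: differ.induct) auto

lemma all_differ_iff: "all_differ S \<longleftrightarrow> distinct S"
  by (induction S) (auto simp: differ_iff list_all_iff)

lemma bounded_iff: "bounded n s \<longleftrightarrow> set s \<subseteq> {..<n}"
  by (induction s) auto

lemma seq_length_eq: "seq_length l s = sum_list (map (\<lambda>a. Suc (l a)) s)"
  by (induction s) auto

lemma inj_join:
  assumes "join m as = join m bs" "\<forall>a\<in>set as. below m a" "\<forall>a\<in>set bs. below m a" "as \<noteq> []" "bs \<noteq> []"
  shows "as = bs"
proof -
  obtain as' a bs' b where "as = as' @ [a]" "bs = bs' @ [b]"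
    using assms(4,5) by (metis rev_exhaust)
  with assms show ?thesis
    using sepcat_unique[of m as' a bs' b] by (auto simp: join_snoc dest!: below_not_in)
qed

text \<open>The induction step of all computations, symbolic or numeric. Suffix data need no theory
  of their own: reversing a joined word reverses the row and each of its blocks.\<close>

theorem represents_step:
  assumes r: "represents m ws T" and ok: "step_ok (length ws) S T"
  shows "represents (Suc m) (next_words m S ws) (step m S T)"
proof -
  obtain l p u e where T: "T = (l, p, u, e)" by (cases T) auto
  define A where "A = {..<length ws}"
  let ?w = "lookup ws"
  have d: "describes m ?w A (lookup l, lookup2 p, lookup2 u, lookup e)"
    using r by (simp add: represents_def T A_def)
  have inj: "inj_on ?w A" and blw: "\<forall>a\<in>A. below m (?w a) \<and> lookup l a = length (?w a)"
    and p: "\<forall>a\<in>A. \<forall>b\<in>A. lookup2 p a b = first_diff m (?w a) (?w b)"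
    and u: "\<forall>a\<in>A. \<forall>b\<in>A. lookup2 u a b = first_diff m (rev (?w a)) (rev (?w b))"
    using d by (auto simp: describes_def)
  have dist: "distinct S" and S: "\<And>s. s \<in> set S \<Longrightarrow> s \<noteq> [] \<and> set s \<subseteq> A"
    and sq: "\<And>s. s \<in> set S \<Longrightarrow> no_square (lookup l, lookup2 p, lookup2 u, lookup e) [] s"
    using ok by (auto simp: T A_def all_differ_iff bounded_iff list_all_iff)
  define W where "W s = join m (map ?w s)" for s
  have injW: "s = t" if "s \<in> set S" "t \<in> set S" "W s = W t" for s t
  proof -
    have "map ?w s = map ?w t"
      using that S[of s] S[of t] blw by (intro inj_join[of m]) (auto simp: W_def)
    then show ?thesis
      using S[of s] S[of t] that by (intro inj_on_map_eq_map[THEN iffD1, of ?w])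
          (auto intro: inj_on_subset[OF inj])
  qed
  have nth: "lookup (next_words m S ws) i = W (S ! i)" if "i < length S" for i
    using that by (simp add: next_words_def W_def lookup_def)
  have len: "length (next_words m S ws) = length S" by (simp add: next_words_def)
  have 1: "inj_on (lookup (next_words m S ws)) {..<length S}"
  proof (rule inj_onI)
    fix i j assume ij: "i \<in> {..<length S}" "j \<in> {..<length S}"
      "lookup (next_words m S ws) i = lookup (next_words m S ws) j"
    then have "S ! i = S ! j" using injW[of "S ! i" "S ! j"] by (auto simp: nth)
    then show "i = j" using dist ij by (auto simp: distinct_conv_nth)
  qed
  have lenW: "seq_length (lookup l) s - 1 = length (W s)" if "s \<in> set S" for s
  proof -
    have "map (\<lambda>a. Suc (length a)) (map ?w s) = map (\<lambda>a. Suc (lookup l a)) s"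
      using S[OF that] blw by auto
    then show ?thesis
      using S[OF that] by (metis W_def length_join map_is_Nil_conv seq_length_eq)
  qed
  have belowW: "below (Suc m) (W s)" if "s \<in> set S" for s
    using S[OF that] blw unfolding W_def by (intro below_join) auto
  have sfW: "squarefree (W s)" if "s \<in> set S" for s
    using squarefree_join[OF d] S[OF that] sq[OF that] by (simp add: W_def)
  have unW: "unblocked (Suc m) (W s) \<subseteq> set (exceptions (lookup l, lookup2 p, lookup2 u, lookup e) m
      0 [] s)"
    if "s \<in> set S" for s
    using unblocked_join[OF d] S[OF that] by (simp add: W_def)
  have pW: "first_diff_seq m (lookup l) (lookup2 p) s t = first_diff (Suc m) (W s)
      (W t)" if "s \<in> set S" "t \<in> set S" for s t
    unfolding W_def using S[OF that(1)] S[OF that(2)] by (intro first_diff_join[OF inj blw p,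
        symmetric]) auto
  have uW: "first_diff_seq m (lookup l) (lookup2 u) (rev s) (rev t) = first_diff (Suc m) (rev (W s))
      (rev (W t))"
    if "s \<in> set S" "t \<in> set S" for s t
  proof -
    have "inj_on (\<lambda>a. rev (?w a)) A" using inj by (auto simp: inj_on_def)
    moreover have "\<forall>a\<in>A. below m (rev (?w a)) \<and> lookup l a = length (rev (?w a))" using blw by auto
    ultimately have "first_diff (Suc m) (join m (map (\<lambda>a. rev (?w a)) (rev s)))
        (join m (map (\<lambda>a. rev (?w a)) (rev t)))
        = first_diff_seq m (lookup l) (lookup2 u) (rev s) (rev t)"
      using S[OF that(1)] S[OF that(2)] u by (intro first_diff_join) auto
    then show ?thesis
      by (simp add: W_def rev_join rev_map comp_def)
  qed
  show ?thesis
    unfolding represents_def T step.simps table_data.simps describes_def len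
    using 1 belowW sfW lenW unW pW uW
    by (simp add: nth) (simp add: lookup_def lookup2_def Let_def)
qed

text \<open>One rewrite step per lookup; recursion on the index would dominate the evaluation.\<close>

lemma lookup_eval:
  "lookup (x0 # xs) 0 = x0"
  "lookup (x0 # x1 # xs) 1 = x1"
  "lookup (x0 # x1 # xs) (Suc 0) = x1"
  "lookup (x0 # x1 # x2 # xs) 2 = x2"
  "lookup (x0 # x1 # x2 # x3 # xs) 3 = x3"
  "lookup (x0 # x1 # x2 # x3 # x4 # xs) 4 = x4"
  "lookup (x0 # x1 # x2 # x3 # x4 # x5 # xs) 5 = x5"
  "lookup (x0 # x1 # x2 # x3 # x4 # x5 # x6 # xs) 6 = x6"
  "lookup (x0 # x1 # x2 # x3 # x4 # x5 # x6 # x7 # xs) 7 = x7"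
  "lookup (x0 # x1 # x2 # x3 # x4 # x5 # x6 # x7 # xs) 8 = lookup xs 0"
  "lookup (x0 # x1 # x2 # x3 # x4 # x5 # x6 # x7 # xs) 9 = lookup xs 1"
  "lookup (x0 # x1 # x2 # x3 # x4 # x5 # x6 # x7 # xs) 10 = lookup xs 2"
  "lookup (x0 # x1 # x2 # x3 # x4 # x5 # x6 # x7 # xs) 11 = lookup xs 3"
  "lookup (x0 # x1 # x2 # x3 # x4 # x5 # x6 # x7 # xs) 12 = lookup xs 4"
  "lookup (x0 # x1 # x2 # x3 # x4 # x5 # x6 # x7 # xs) 13 = lookup xs 5"
  "lookup (x0 # x1 # x2 # x3 # x4 # x5 # x6 # x7 # xs) 14 = lookup xs 6"
  "lookup (x0 # x1 # x2 # x3 # x4 # x5 # x6 # x7 # xs) 15 = lookup xs 7"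
  "lookup (x0 # x1 # x2 # x3 # x4 # x5 # x6 # x7 # xs) 16 = lookup xs 8"
  "lookup (x0 # x1 # x2 # x3 # x4 # x5 # x6 # x7 # xs) 17 = lookup xs 9"
  "lookup (x0 # x1 # x2 # x3 # x4 # x5 # x6 # x7 # xs) 18 = lookup xs 10"
  "lookup (x0 # x1 # x2 # x3 # x4 # x5 # x6 # x7 # xs) 19 = lookup xs 11"
  "lookup (x0 # x1 # x2 # x3 # x4 # x5 # x6 # x7 # xs) 20 = lookup xs 12"
  "lookup (x0 # x1 # x2 # x3 # x4 # x5 # x6 # x7 # xs) 21 = lookup xs 13"
  "lookup (x0 # x1 # x2 # x3 # x4 # x5 # x6 # x7 # xs) 22 = lookup xs 14"
  "lookup (x0 # x1 # x2 # x3 # x4 # x5 # x6 # x7 # xs) 23 = lookup xs 15"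
  by (simp_all add: lookup_def)

lemma lookup2_eval:
  "lookup2 (x0 # xs) 0 j = lookup x0 j"
  "lookup2 (x0 # x1 # xs) 1 j = lookup x1 j"
  "lookup2 (x0 # x1 # xs) (Suc 0) j = lookup x1 j"
  "lookup2 (x0 # x1 # x2 # xs) 2 j = lookup x2 j"
  "lookup2 (x0 # x1 # x2 # x3 # xs) 3 j = lookup x3 j"
  "lookup2 (x0 # x1 # x2 # x3 # x4 # xs) 4 j = lookup x4 j"
  "lookup2 (x0 # x1 # x2 # x3 # x4 # x5 # xs) 5 j = lookup x5 j"
  "lookup2 (x0 # x1 # x2 # x3 # x4 # x5 # x6 # xs) 6 j = lookup x6 j"
  "lookup2 (x0 # x1 # x2 # x3 # x4 # x5 # x6 # x7 # xs) 7 j = lookup x7 j"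
  "lookup2 (x0 # x1 # x2 # x3 # x4 # x5 # x6 # x7 # xs) 8 j = lookup2 xs 0 j"
  "lookup2 (x0 # x1 # x2 # x3 # x4 # x5 # x6 # x7 # xs) 9 j = lookup2 xs 1 j"
  "lookup2 (x0 # x1 # x2 # x3 # x4 # x5 # x6 # x7 # xs) 10 j = lookup2 xs 2 j"
  "lookup2 (x0 # x1 # x2 # x3 # x4 # x5 # x6 # x7 # xs) 11 j = lookup2 xs 3 j"
  "lookup2 (x0 # x1 # x2 # x3 # x4 # x5 # x6 # x7 # xs) 12 j = lookup2 xs 4 j"
  "lookup2 (x0 # x1 # x2 # x3 # x4 # x5 # x6 # x7 # xs) 13 j = lookup2 xs 5 j"
  "lookup2 (x0 # x1 # x2 # x3 # x4 # x5 # x6 # x7 # xs) 14 j = lookup2 xs 6 j"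
  "lookup2 (x0 # x1 # x2 # x3 # x4 # x5 # x6 # x7 # xs) 15 j = lookup2 xs 7 j"
  "lookup2 (x0 # x1 # x2 # x3 # x4 # x5 # x6 # x7 # xs) 16 j = lookup2 xs 8 j"
  "lookup2 (x0 # x1 # x2 # x3 # x4 # x5 # x6 # x7 # xs) 17 j = lookup2 xs 9 j"
  "lookup2 (x0 # x1 # x2 # x3 # x4 # x5 # x6 # x7 # xs) 18 j = lookup2 xs 10 j"
  "lookup2 (x0 # x1 # x2 # x3 # x4 # x5 # x6 # x7 # xs) 19 j = lookup2 xs 11 j"
  "lookup2 (x0 # x1 # x2 # x3 # x4 # x5 # x6 # x7 # xs) 20 j = lookup2 xs 12 j"
  "lookup2 (x0 # x1 # x2 # x3 # x4 # x5 # x6 # x7 # xs) 21 j = lookup2 xs 13 j"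
  "lookup2 (x0 # x1 # x2 # x3 # x4 # x5 # x6 # x7 # xs) 22 j = lookup2 xs 14 j"
  "lookup2 (x0 # x1 # x2 # x3 # x4 # x5 # x6 # x7 # xs) 23 j = lookup2 xs 15 j"
  by (simp_all add: lookup_def lookup2_def)

text \<open>The repeats before each block of a row serve both the square test and the exceptions.
  The tests that follow branch by \<open>if\<close> because the simplifier then evaluates only the
  branch that is taken, while it would evaluate both sides of a conjunction.\<close>

fun history :: "'a list \<Rightarrow> 'a list \<Rightarrow> ('a \<times> 'a) list list" where
  "history h [] = [repeat_list h]"
| "history h (z # s) = repeat_list h # history (z # h) s"

fun gaps_ok :: "'a data \<Rightarrow> 'a \<Rightarrow> ('a \<times> 'a) list \<Rightarrow> bool" where
  "gaps_ok d z [] = True"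
| "gaps_ok (l, p, u, e) z ((g, x) # M) =
     (if fst (u x g) + fst (p g z) < l g then gaps_ok (l, p, u, e) z M else False)"

fun no_square_from :: "'a data \<Rightarrow> ('a \<times> 'a) list list \<Rightarrow> 'a list \<Rightarrow> bool" where
  "no_square_from d (M # Ms) (z # s) = (if gaps_ok d z M then no_square_from d Ms s else False)"
| "no_square_from d Ms s = True"

fun blocked :: "'a data \<Rightarrow> nat \<Rightarrow> 'a \<Rightarrow> nat \<Rightarrow> nat \<Rightarrow> ('a \<times> 'a) list \<Rightarrow> bool" where
  "blocked d m z q c [] = False"
| "blocked (l, p, u, e) m z q c ((g, x) # M) =
     (if p z g = (q, c) then if c < m then if l g \<le> Suc q + fst (u g x) then True
      else blocked (l, p, u, e) m z q c M else blocked (l, p, u, e) m z q c M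
      else blocked (l, p, u, e) m z q c M)"

fun sieve :: "'a data \<Rightarrow> nat \<Rightarrow> nat \<Rightarrow> 'a \<Rightarrow> ('a \<times> 'a) list \<Rightarrow> (nat \<times> nat) list \<Rightarrow> (nat \<times> nat) list" where
  "sieve d m k z M [] = []"
| "sieve d m k z M ((q, c) # E) = (if blocked d m z q c M then sieve d m k z M E else
    (k + q, c) # sieve d m k z M E)"

fun end_blocked :: "'a data \<Rightarrow> ('a \<times> 'a) list \<Rightarrow> bool" where
  "end_blocked d [] = False"
| "end_blocked (l, p, u, e) ((g, x) # M) = (if l g \<le> fst (u g x) then True else
    end_blocked (l, p, u, e) M)"

fun exceptions_from :: "'a data \<Rightarrow> nat \<Rightarrow> nat \<Rightarrow> ('a \<times> 'a) list list \<Rightarrow> 'a list \<Rightarrow> (nat \<times> nat) list" where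
  "exceptions_from (l, p, u, e) m k (M # Ms) (z # s) =
     sieve (l, p, u, e) m k z M (e z) @ exceptions_from (l, p, u, e) m (k + Suc (l z)) Ms s"
| "exceptions_from d m k (M # Ms) [] = (if end_blocked d M then [] else [(k - 1, m)])"
| "exceptions_from d m k [] s = []"

lemma gaps_ok_iff: "gaps_ok (l, p, u, e) z M \<longleftrightarrow> (\<forall>(g, x)\<in>set M. fst (u x g) + fst (p g z) < l g)"
  by (induction M) (auto split: if_splits)

lemma blocked_iff:
  "blocked (l, p, u, e) m z q c M \<longleftrightarrow>
    (\<exists>(g, x)\<in>set M. p z g = (q, c) \<and> c < m \<and> l g \<le> Suc q + fst (u g x))"
  by (induction M) (auto split: if_splits)

lemma end_blocked_iff: "end_blocked (l, p, u, e) M \<longleftrightarrow> (\<exists>(g, x)\<in>set M. l g \<le> fst (u g x))"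
  by (induction M) (auto split: if_splits)

lemma sieve_eq: "sieve d m k z M E = map (\<lambda>(q, c). (k + q, c)) (filter (\<lambda>(q, c). \<not> blocked d m z q c
    M) E)"
  by (induction E) auto

lemma no_square_from_history: "no_square_from d (history h s) s = no_square d h s"
  by (induction h s rule: history.induct; cases d) (auto simp: gaps_ok_iff)

lemma exceptions_from_history: "exceptions_from d m k (history h s) s = exceptions d m k h s"
proof (induction h s arbitrary: k rule: history.induct)
  case (1 h)
  then show ?case by (cases d) (auto simp: end_blocked_iff)
next
  case (2 h z s)
  then show ?case by (cases d) (simp add: sieve_eq blocked_iff)
qed

primrec diff_row :: "nat \<Rightarrow> (nat \<Rightarrow> nat) \<Rightarrow> (nat \<Rightarrow> nat \<Rightarrow> nat \<times> nat) \<Rightarrow> nat list \<Rightarrow> nat list list \<Rightarrow> (nat \<times>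
    nat) list" where
  "diff_row m l p s [] = []"
| "diff_row m l p s (t # S) = first_diff_seq m l p s t # diff_row m l p s S"

primrec diff_rows where
  "diff_rows m l p S [] = []"
| "diff_rows m l p S (s # R) = diff_row m l p s S # diff_rows m l p S R"

primrec scan_rows :: "nat data \<Rightarrow> nat \<Rightarrow> nat list list \<Rightarrow> (bool \<times> (nat \<times> nat) list) list" where
  "scan_rows d m [] = []"
| "scan_rows d m (s # R) = (let Ms = history [] s in (no_square_from d Ms s,
    exceptions_from d m 0 Ms s)) # scan_rows d m R"

primrec bounded_all where
  "bounded_all n [] = True"
| "bounded_all n (s # R) = (if s = [] then False else if bounded n s then bounded_all n R else False)"

definition check_step :: "nat \<Rightarrow> nat \<Rightarrow> nat list list \<Rightarrow> table \<Rightarrow> bool \<times> table" where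
  "check_step n m S T = (step_ok n S T, step m S T)"

lemma check_step_eval:
  "check_step n m S (l, p, u, e) =
    (let X = scan_rows (lookup l, lookup2 p, lookup2 u, lookup e) m S; R = map rev S in
     (all_differ S \<and> bounded_all n S \<and> list_all fst X,
      map (\<lambda>s. seq_length (lookup l) s - 1) S, diff_rows m (lookup l)
          (lookup2 p) S S, diff_rows m (lookup l) (lookup2 u) R R, map snd X))"
proof -
  have "diff_row m l p s S = map (first_diff_seq m l p s) S" for l p s S by (induction S) auto
  then have 1: "diff_rows m l p S R = map (\<lambda>s. map (first_diff_seq m l p s) S) R" for l p S R by
      (induction R) auto
  have 2: "scan_rows d m S = map (\<lambda>s. (no_square d [] s, exceptions d m 0 [] s)) S" for d
    by (induction S) (auto simp: Let_def no_square_from_history exceptions_from_history)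
  have 3: "bounded_all n S = list_all (\<lambda>s. s \<noteq> [] \<and> bounded n s) S" by (induction S) auto
  show ?thesis
    unfolding check_step_def step.simps step_ok.simps 1 2 3
    by (auto simp: Let_def list_all_iff)
qed

text \<open>With \<^const>\<open>Suc\<close> the simplifier would compute unary numbers.\<close>

lemma plus_one_eval:
  "seq_length l (a # s) = l a + 1 + seq_length l s"
  "exceptions_from (l, p, u, e) m k (M # Ms) (z # s) =
     sieve (l, p, u, e) m k z M (e z) @ exceptions_from (l, p, u, e) m (k + l z + 1) Ms s"
  "blocked (l, p, u, e) m z q c ((g, x) # M) =
     (if p z g = (q, c) then if c < m then if l g \<le> q + 1 + fst (u g x) then True
      else blocked (l, p, u, e) m z q c M else blocked (l, p, u, e) m z q c M
      else blocked (l, p, u, e) m z q c M)"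
  "first_diff_seq m l p (a # a' # s) (b # b' # t) =
     (if a = b then (case first_diff_seq m l p (a' # s) (b' # t) of (q, c) \<Rightarrow> (l a + 1 + q, c)) else
         p a b)"
  "first_diff_seq m l p (a # a' # s) [b] =
     (if a = b then (l a, m + 1) else if snd (p a b) = m then (fst (p a b), m + 1) else p a b)"
  "first_diff_seq m l p [a] [b] =
     (if a = b then (l a, m + 1) else if snd (p a b) = m then (fst (p a b), m + 1) else p a b)"
  by (simp_all split: prod.splits)

lemma history_eval:
  "history [] [] = [[]]" "history (y # h) [] = [repeat_list_from [] (y # h) (y # h) h]"
  "history [] (z # s) = [] # history [z] s"
  "history (y # h) (z # s) = repeat_list_from [] (y # h) (y # h) h # history (z # y # h) s"
  by simp_all

definition repeat_list_if where
  "repeat_list_if c g x n h t f = (if c then (g, x) # repeat_list_from (g # n) h t f else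
      repeat_list_from (g # n) h t f)"

lemma repeat_list_eval:
  "repeat_list_from n h (g # t) [x] = (if agree n h t then [(g, x)] else [])"
  "repeat_list_from n h (g # t) (x # y # f) = repeat_list_if (agree n h t) g x n h t f"
  "repeat_list_if True g x n h t f = (g, x) # repeat_list_from (g # n) h t f"
  "repeat_list_if False g x n h t f = repeat_list_from (g # n) h t f"
  by (simp_all add: repeat_list_if_def)

lemma bounded_eval: "bounded n (a # s) = (if a < n then bounded n s else False)"
  by simp

lemma rev_eval: "rev xs = fold Cons xs []"
  by (simp add: rev_conv_fold)

text \<open>These congruence rules keep the simplifier from visiting arguments that are already literal
  lists; without them every rewrite step traverses all remaining data.\<close>

lemma eval_cong:
  "i = i' \<Longrightarrow> lookup xs i = lookup xs i'"
  "i = i' \<Longrightarrow> lookup2 ys i j = lookup2 ys i' j"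
  "agree n r t = agree n r t"
  "repeat_list_from n r t s = repeat_list_from n r t s"
  "C = C' \<Longrightarrow> repeat_list_if C u v n r t s = repeat_list_if C' u v n r t s"
  "history n r = history n r"
  "no_square_from d Ms s = no_square_from d Ms s"
  "k = k' \<Longrightarrow> exceptions_from d m k Ms s = exceptions_from d m k' Ms s"
  "gaps_ok d z M = gaps_ok d z M"
  "blocked d m z q c M = blocked d m z q c M"
  "end_blocked d M = end_blocked d M"
  "E = E' \<Longrightarrow> sieve d m k z M E = sieve d m k z M E'"
  "first_diff_seq m f p h s = first_diff_seq m f p h s"
  "diff_row m f p h S = diff_row m f p h S"
  "diff_rows m f p S R = diff_rows m f p S R"
  "scan_rows d m S = scan_rows d m S"
  "differ a b = differ a b"
  "bounded k a = bounded k a"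
  "bounded_all k S = bounded_all k S"
  "seq_length f a = seq_length f a"
  "fold g h v = fold g h v"
  by auto

lemmas eval_simps = plus_one_eval repeat_list_eval history_eval lookup_eval lookup2_eval
    bounded_eval rev_eval Let_def check_step_eval

lemmas eval_del = One_nat_def seq_length.simps(2) exceptions_from.simps(1) blocked.simps(2)
    first_diff_seq.simps(1,2,4)
  history.simps repeat_list_from.simps(1)

section \<open>The tail and the greedy characterization\<close>

lemma morph_simps [simp]:
  "morph f [] = []" "morph f (a # w) = f a @ morph f w" "morph f (u @ v) = morph f u @ morph f v"
  by (auto simp: morph_def)

definition ruler_init :: "nat \<Rightarrow> nat list" where "ruler_init n = butlast (ruler n)"

lemma ruler_Suc: "ruler (Suc n) = morph rho (ruler n)"
  by (simp add: ruler_def)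

lemma morph_rho_Cons: "morph rho (a # w) = 0 # Suc a # morph rho w"
  by (simp add: rho_def)

lemma ruler_eq: "ruler n = ruler_init n @ [n]" and ruler_init_Suc_rho: "ruler_init (Suc n) =
    morph rho (ruler_init n) @ [0]"
proof -
  have "ruler n = ruler_init n @ [n] \<and> ruler_init (Suc n) = morph rho (ruler_init n) @ [0]"
  proof (induction n)
    case 0
    show ?case by (simp add: ruler_init_def ruler_def morph_rho_Cons del: morph_simps(2))
  next
    case (Suc n)
    then have 1: "ruler (Suc n) = ruler_init (Suc n) @ [Suc n]"
      by (simp add: ruler_Suc morph_rho_Cons del: morph_simps(2))
    then have "ruler (Suc (Suc n)) = (morph rho (ruler_init (Suc n)) @ [0]) @ [Suc (Suc n)]"
      unfolding ruler_Suc[of "Suc n"] by (simp add: morph_rho_Cons del: morph_simps(2))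
    with 1 show ?case by (simp add: ruler_init_def butlast_append)
  qed
  then show "ruler n = ruler_init n @ [n]" "ruler_init (Suc n) = morph rho (ruler_init n) @ [0]" by auto
qed

lemma ruler_init_0 [simp]: "ruler_init 0 = []"
  by (simp add: ruler_init_def ruler_def)

lemma ruler_init_Suc: "ruler_init (Suc n) = ruler_init n @ n # ruler_init n"
proof (induction n)
  case 0
  show ?case by (simp add: ruler_init_Suc_rho)
next
  case (Suc n)
  have "ruler_init (Suc (Suc n)) = morph rho (ruler_init n @ n # ruler_init n) @ [0]"
    by (simp only: ruler_init_Suc_rho[of "Suc n"] Suc)
  then show ?case
    by (simp add: ruler_init_Suc_rho[of n] morph_rho_Cons del: morph_simps(2))
qed

lemma ruler_init_join: "ruler_init (Suc n) = join n [ruler_init n, ruler_init n]"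
  by (simp add: ruler_init_Suc)

lemma length_ruler_init: "length (ruler_init n) = 2 ^ n - 1"
proof -
  have "Suc (length (ruler_init n)) = 2 ^ n"
    by (induction n) (simp_all add: ruler_init_Suc)
  then show ?thesis by simp
qed

text \<open>\<open>D_word M\<close> is the prefix of \<open>\<rho>(\<alpha>(L(\<epsilon>)))\<close> before its first letter \<open>\<ge> M\<close>, for \<open>M \<ge> 6\<close>.\<close>

definition Q_word :: "nat \<Rightarrow> nat list" where
  "Q_word M = morph rho (C_word @ butlast (alpha (M - 5))) @ [0]"

definition D_word :: "nat \<Rightarrow> nat list" where
  "D_word M = morph rho (morph alpha (ruler_init (M - 4)) @ butlast (alpha (M - 5))) @ [0]"

lemma alpha_Suc_eq: "alpha (Suc k) = butlast (alpha (Suc k)) @ [k + 4]"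
proof (induction k)
  case 0
  have "ruler 4 = ruler_init 4 @ [4]" by (rule ruler_eq)
  then show ?case by (simp add: butlast_append)
next
  case (Suc k)
  have "ruler (k + 5) = ruler_init (k + 5) @ [k + 5]" by (rule ruler_eq)
  then show ?case by (simp add: butlast_append ac_simps)
qed

lemma alpha_Suc_Suc:
  "alpha (Suc (Suc k)) =
    butlast (alpha (Suc k)) @ (k + 5) # ruler_init (k + 5) @ (k + 5) # C_word @
    butlast (alpha (Suc k)) @ (k + 5) # ruler_init (k + 5) @ [k + 5]"
proof -
  have "last (alpha (Suc k)) = k + 4" by (metis alpha_Suc_eq last_snoc)
  then show ?thesis
    using ruler_eq[of "k + 5"] by (simp add: inc_last_def ac_simps)
qed

text \<open>The 0 that ends \<open>Q_word M\<close> and \<open>D_word M\<close> is the first letter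
  of \<open>rho (M - 1) = [0, M]\<close>, whose second letter is the cut; likewise
  \<open>ruler_init M\<close> is the image of \<open>ruler_init (M - 1)\<close> completed by such a
  0. With these, the formula for \<open>alpha (M - 4)\<close> translates piece by piece, and
  \<open>ruler_init (M - 3) = ruler_init (M - 4) @ (M - 4) # ruler_init (M - 4)\<close> gives the
  two copies of \<open>D_word M\<close>.\<close>

lemma alpha_step:
  assumes "M \<ge> 6"
  shows "Q_word (Suc M) = join M [Q_word M, ruler_init M, Q_word M, ruler_init M]"
    and "D_word (Suc M) = join M [D_word M, ruler_init M, Q_word M, ruler_init M, D_word M,
        ruler_init M, Q_word M, ruler_init M]"
proof -
  obtain k where M: "M = k + 6" using assms by (metis add.commute le_Suc_ex)
  define H where "H = butlast (alpha (Suc k))"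
  define S where "S = morph alpha (ruler_init (k + 2))"
  have a: "alpha (Suc (Suc k)) = H @ (k + 5) # ruler_init (k + 5) @ (k + 5) # C_word @ H @ (k + 5) #
      ruler_init (k + 5) @ [k + 5]"
    unfolding H_def by (rule alpha_Suc_Suc)
  have b: "butlast (alpha (Suc (Suc k))) = H @ (k + 5) # ruler_init (k + 5) @ (k + 5) # C_word @ H @
      (k + 5) # ruler_init (k + 5)"
    unfolding a by (simp add: butlast_append)
  have idx: "k + 7 - 5 = Suc (Suc k)" "k + 6 - 5 = Suc k" "k + 7 - 4 = Suc (k + 2)" "k + 6 - 4 = k + 2"
    by auto
  have ruler_init: "ruler_init (k + 6) = morph rho (ruler_init (k + 5)) @ [0]"
  proof -
    have "Suc (k + 5) = k + 6" by simp
    then show ?thesis using ruler_init_Suc_rho[of "k + 5"] by metis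
  qed
  have Q: "Q_word (k + 6) = morph rho C_word @ morph rho H @ [0]"
    unfolding Q_word_def idx H_def by simp
  have D: "D_word (k + 6) = morph rho S @ morph rho H @ [0]"
    unfolding D_word_def idx H_def S_def by simp
  have S: "morph alpha (ruler_init (Suc (k + 2))) = S @ alpha (Suc (Suc k)) @ S"
    unfolding ruler_init_Suc S_def by simp
  have rl: "rho (k + 5) = [0, k + 6]" by (simp add: rho_def)
  have "Q_word (k + 7) = join (k + 6) [Q_word (k + 6), ruler_init (k + 6), Q_word (k + 6),
      ruler_init (k + 6)]"
    unfolding Q ruler_init unfolding Q_word_def idx b by (simp add: rl)
  moreover have "D_word (k + 7) = join (k + 6)
      [D_word (k + 6), ruler_init (k + 6), Q_word (k + 6), ruler_init (k + 6), D_word (k + 6),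
          ruler_init (k + 6), Q_word (k + 6), ruler_init (k + 6)]"
    unfolding Q ruler_init D unfolding D_word_def idx b S unfolding a by (simp add: rl)
  moreover have Sk: "Suc M = k + 7" using M by simp
  ultimately show "Q_word (Suc M) = join M [Q_word M, ruler_init M, Q_word M, ruler_init M]"
    "D_word (Suc M) = join M [D_word M, ruler_init M, Q_word M, ruler_init M, D_word M,
        ruler_init M, Q_word M, ruler_init M]"
    unfolding Sk unfolding M by (simp_all only:)
qed

section \<open>A criterion for \<open>L w\<close> in terms of finite prefixes\<close>

definition prefix_of :: "nat list \<Rightarrow> nat stream \<Rightarrow> bool" where
  "prefix_of w x \<longleftrightarrow> stake (length w) x = w"

lemma prefix_of_shift: "prefix_of u (u @- x)"
  by (simp add: prefix_of_def stake_shift)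

lemma prefix_of_iff: "prefix_of w x \<longleftrightarrow> (\<exists>y. x = w @- y)"
  by (metis prefix_of_def prefix_of_shift stake_sdrop)

lemma prefix_of_prefix: "prefix_of (u @ v) x \<Longrightarrow> prefix_of u x"
  unfolding prefix_of_iff by auto

lemma smorph_shift:
  assumes "\<And>n. f n \<noteq> []"
  shows "smorph f (u @- x) = morph f u @- smorph f x"
  unfolding smorph_def
proof (induction u)
  case (Cons a u)
  then show ?case using assms by (simp add: flat_Stream)
qed simp

text \<open>A competitor \<open>y\<close> agrees with \<open>x\<close> on \<open>w\<close>. If its
  first differing letter is the smaller one, that letter is blocked, so \<open>y\<close> contains a
  square ending at that position, which lies beyond \<open>w\<close>. Uniqueness of the minimum is
  asymmetry of the lexicographic order.\<close>

lemma L_eqI: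
  assumes pre: "prefix_of w x"
    and chain: "\<And>N. \<exists>u m. N \<le> length u \<and> prefix_of u x \<and> squarefree u \<and>
        (\<forall>(q, c)\<in>unblocked m u. q < length w)"
  shows "L w = x"
proof -
  have sq: "squarefree_ext w x"
    unfolding squarefree_ext_def
  proof (intro conjI allI impI)
    show "stake (length w) x = w" using pre by (simp add: prefix_of_def)
    fix i n assume "square (stake n (sdrop i x))"
    then obtain y where y: "y \<noteq> []" "stake n (sdrop i x) = y @ y"
      by (auto simp: square_def)
    obtain u m where u: "i + n \<le> length u" "prefix_of u x" "squarefree u"
      using chain by blast
    have "stake (i + n) x = stake i x @ y @ y"
      using y by (simp add: stake_add[symmetric])
    moreover have "u = stake (i + n) x @ drop (i + n) u"
    proof -
      have "take (i + n) u = stake (i + n) x"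
        using u(1,2) by (metis min.absorb1 prefix_of_def take_stake)
      then show ?thesis by (metis append_take_drop_id)
    qed
    ultimately have "u = stake i x @ y @ y @ drop (i + n) u" by simp
    then show "i + n \<le> length w" using u(3) y(1) unfolding squarefree_def by blast
  qed
  have least: "x = y \<or> x \<prec> y" if y: "squarefree_ext w y" for y
  proof (rule ccontr)
    assume no: "\<not> (x = y \<or> x \<prec> y)"
    then have "\<exists>i. x !! i \<noteq> y !! i"
      by (metis id_apply smap_alt stream.map_id)
    then obtain i where i: "x !! i \<noteq> y !! i" and min: "\<And>j. j < i \<Longrightarrow> x !! j = y !! j"
      using exists_least_iff[of "\<lambda>i. x !! i \<noteq> y !! i"] by auto
    have st: "stake i x = stake i y"
      by (rule nth_equalityI) (auto simp: min)
    then have less: "y !! i < x !! i"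
      using no i unfolding lex_less_def by (metis linorder_neqE_nat)
    have iw: "length w \<le> i"
    proof (rule ccontr)
      assume "\<not> length w \<le> i"
      then have "x !! i = w ! i" "y !! i = w ! i"
        using pre y by (metis prefix_of_def stake_nth not_le, metis squarefree_ext_def stake_nth not_le)
      with i show False by simp
    qed
    obtain u m where u: "Suc i \<le> length u" "prefix_of u x" "\<forall>(q, c)\<in>unblocked m u. q < length w"
      using chain by blast
    have ui: "u ! i = x !! i" "take i u = stake i x"
      using u(1,2) by (metis Suc_le_lessD prefix_of_def stake_nth, metis Suc_leD min.absorb1
          prefix_of_def take_stake)
    have "(i, y !! i) \<notin> unblocked m u"
      using u(3) iw by auto
    then have "ends_in_square (stake i x @ [y !! i])"
      using u(1) ui less by (auto simp: unblocked_def nth_append)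
    then obtain v z where z: "z \<noteq> []" "stake i y @ [y !! i] = v @ z @ z"
      unfolding st ends_in_square_def by blast
    then have yv: "stake (Suc i) y = v @ z @ z"
      by (metis stake_Suc)
    have len: "Suc i = length v + length (z @ z)"
      using arg_cong[OF yv, of length] by simp
    have "stake (length (z @ z)) (sdrop (length v) y) = z @ z"
    proof -
      have "stake (length v + length (z @ z)) y = v @ z @ z" using yv len by simp
      then have "stake (length v) y @ stake (length (z @ z)) (sdrop (length v) y) = v @ z @ z"
        by (simp only: stake_add)
      then show ?thesis by (metis append_eq_append_conv length_stake)
    qed
    then have "square (stake (length (z @ z)) (sdrop (length v) y))"
      unfolding square_def using z(1) by auto
    then have "length v + length (z @ z) \<le> length w"
      using y unfolding squarefree_ext_def by blast
    with len iw show False by simp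
  qed
  show ?thesis
    unfolding L_def
  proof (rule the_equality)
    show "squarefree_ext w x \<and> (\<forall>y. squarefree_ext w y \<longrightarrow> x = y \<or> x \<prec> y)"
      using sq least by blast
    fix x' assume x': "squarefree_ext w x' \<and> (\<forall>y. squarefree_ext w y \<longrightarrow> x' = y \<or> x' \<prec> y)"
    show "x' = x"
    proof (rule ccontr)
      assume "x' \<noteq> x"
      then have "x \<prec> x'" "x' \<prec> x" using x' sq least by auto
      then obtain i j where ij: "stake i x = stake i x'" "x !! i < x' !! i" "stake j x' = stake j x"
          "x' !! j < x !! j"
        unfolding lex_less_def by blast
      show False
      proof (cases i j rule: linorder_cases)
        case less
        then show ?thesis using ij by (metis nat_neq_iff stake_nth)
      next
        case greater
        then show ?thesis using ij by (metis nat_neq_iff stake_nth)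
      qed (use ij in simp)
    qed
  qed
qed

section \<open>The ruler sequence as \<open>L []\<close>\<close>

fun ruler_table :: "nat \<Rightarrow> nat \<Rightarrow> table" where
  "ruler_table M l = ([l], [[(l, M)]], [[(l, M)]], [[]])"

lemma unblocked_Nil: "unblocked m [] \<subseteq> (\<lambda>c. (0, c)) ` {..<m}"
  by (auto simp: unblocked_def)

lemma squarefree_Nil: "squarefree []"
  by (simp add: squarefree_def)

lemma represents_0: "represents 0 [[]] (ruler_table 0 0)"
  using unblocked_Nil[of 0] squarefree_Nil by (auto simp: represents_def describes_def lessThan_Suc
      lookup_eval lookup2_eval)

text \<open>The simplest instance of the method: the single row \<open>[0, 0]\<close> reproduces its
  own table with an empty list of exceptions.\<close>

lemma represents_ruler_init: "\<exists>l. represents M [ruler_init M] (ruler_table M l)"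
proof (induction M)
  case 0
  show ?case using represents_0 by auto
next
  case (Suc M)
  then obtain l where "represents M [ruler_init M] (ruler_table M l)" by blast
  then have "represents (Suc M) (next_words M [[0, 0]] [ruler_init M]) (step M [[0, 0]]
      (ruler_table M l))"
    by (rule represents_step) simp
  moreover have "next_words M [[0, 0]] [ruler_init M] = [ruler_init (Suc M)]"
    by (simp add: next_words_def ruler_init_join lookup_eval)
  moreover have "step M [[0, 0]] (ruler_table M l) = ruler_table (Suc M) (2 * l + 1)"
    by (simp add: lookup_eval lookup2_eval)
  ultimately show ?case by metis
qed

lemma ruler_init_squarefree: "squarefree (ruler_init M)" and ruler_init_unblocked: "unblocked M
    (ruler_init M) = {}"
  using represents_ruler_init[of M] by (auto simp: represents_def describes_def lookup_eval)

definition ruler_stream :: "nat stream" where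
  "ruler_stream = smap (\<lambda>i. ruler_init (Suc i) ! i) nats"

lemma ruler_init_prefix: "M \<le> N \<Longrightarrow> \<exists>v. ruler_init N = ruler_init M @ v"
proof (induction N rule: dec_induct)
  case (step N)
  then show ?case by (auto simp: ruler_init_Suc)
qed simp

lemma ruler_init_prefix_of_stream: "prefix_of (ruler_init M) ruler_stream"
  unfolding prefix_of_def
proof (rule nth_equalityI)
  fix i assume "i < length (stake (length (ruler_init M)) ruler_stream)"
  then have i: "i < length (ruler_init M)" by simp
  have "Suc i \<le> 2 ^ i" by (rule Suc_leI) (rule less_exp)
  then have "Suc i < 2 * 2 ^ i" by simp
  then have i': "i < length (ruler_init (Suc i))"
    by (simp add: length_ruler_init less_diff_conv)
  have "ruler_init (Suc i) ! i = ruler_init M ! i"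
  proof (cases "M \<le> Suc i")
    case True
    then obtain v where "ruler_init (Suc i) = ruler_init M @ v" using ruler_init_prefix by blast
    then show ?thesis using i by (simp add: nth_append)
  next
    case False
    then obtain v where "ruler_init M = ruler_init (Suc i) @ v" using ruler_init_prefix[of "Suc i"
        M] by auto
    then show ?thesis using i' by (simp add: nth_append)
  qed
  then show "stake (length (ruler_init M)) ruler_stream ! i = ruler_init M ! i"
    using i by (simp add: ruler_stream_def)
qed simp

lemma L_Nil: "L [] = ruler_stream"
proof (rule L_eqI)
  show "prefix_of [] ruler_stream" by (simp add: prefix_of_def)
  fix N
  have "N < 2 ^ N" by (rule less_exp)
  then have "Suc N \<le> 2 * 2 ^ N" by linarith
  then have "N \<le> length (ruler_init (Suc N))" by (simp add: length_ruler_init)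
  then show "\<exists>u m. N \<le> length u \<and> prefix_of u ruler_stream \<and> squarefree u \<and>
      (\<forall>(q, c)\<in>unblocked m u. q < length ([]::nat list))"
    using ruler_init_prefix_of_stream ruler_init_squarefree ruler_init_unblocked by (metis empty_iff)
qed

lemma alpha_not_Nil: "alpha n \<noteq> []"
  by (cases n rule: alpha.cases) (auto simp: E_word_def C_word_def)

text \<open>In \<open>L []\<close> the word \<open>ruler_init (M - 4)\<close> is followed by
  \<open>M - 4\<close>, and \<open>alpha (M - 4)\<close> begins with
  \<open>butlast (alpha (M - 5))\<close> and one further letter; the \<open>rho\<close>-image of
  that letter supplies the final 0.\<close>

lemma D_word_prefix:
  assumes "M \<ge> 6"
  shows "prefix_of (D_word M) (smorph rho (smorph alpha (L [])))"
proof -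
  obtain k where M: "M = k + 6" using assms by (metis add.commute le_Suc_ex)
  have "ruler_init (Suc (k + 2)) = ruler_init (k + 2) @ (k + 2) # ruler_init (k + 2)"
    by (rule ruler_init_Suc)
  then obtain x where "L [] = (ruler_init (k + 2) @ [k + 2]) @- x"
    using ruler_init_prefix_of_stream[of "Suc (k + 2)"] unfolding L_Nil prefix_of_iff by auto
  then have 1: "smorph alpha (L []) = morph alpha (ruler_init (k + 2) @ [k + 2]) @- smorph alpha x"
    using smorph_shift[of alpha, OF alpha_not_Nil] by metis
  have "\<exists>d v. alpha (k + 2) = butlast (alpha (Suc k)) @ d # v"
    using alpha_Suc_Suc[of k] by simp
  then obtain d v where "alpha (k + 2) = butlast (alpha (Suc k)) @ d # v"
    by blast
  then have 2: "smorph alpha (L []) = (morph alpha (ruler_init (k + 2)) @ butlast (alpha (Suc k)) @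
      d # v) @- smorph alpha x"
    unfolding 1 by simp
  have "smorph rho (smorph alpha (L [])) =
      morph rho (morph alpha (ruler_init (k + 2)) @ butlast (alpha (Suc k)) @ d # v) @- smorph rho
          (smorph alpha x)"
    unfolding 2 by (rule smorph_shift) (simp add: rho_def)
  then have "smorph rho (smorph alpha (L [])) = D_word M @- (Suc d # morph rho v) @- smorph rho
      (smorph alpha x)"
    by (simp add: D_word_def M rho_def)
  then show ?thesis
    unfolding prefix_of_iff by blast
qed

section \<open>The recurrence for large letters\<close>

lemmas symbolic_eval = plus_one_eval(2-) lookup_eval lookup2_eval Let_def

text \<open>The blocks are \<open>ruler_init M\<close>, \<open>Q_word M\<close>, \<open>D_word M\<close>, words \<open>A\<close>, \<open>B\<close>, \<open>J\<close>, and the empty word.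
  For \<open>M = n + 1\<close>, in the paper's notation, \<open>J\<close> is the part of \<open>L(n)\<close> between its first letter and
  the first letter above \<open>n\<close>, and with \<open>r\<^sub>k\<close> for \<open>ruler_init k\<close>, \<open>A\<close> is \<open>P\<^sub>0(n) \<psi>\<^sub>1(r\<^sub>n)\<close> and \<open>B\<close> is
  \<open>P\<^sub>0(n) P\<^sub>1(n) \<psi>\<^sub>2(r\<^sub>n\<^sub>-\<^sub>1)\<close>.\<close>

fun core_table :: "nat \<Rightarrow> nat \<Rightarrow> nat \<Rightarrow> nat \<Rightarrow> nat \<Rightarrow> nat \<Rightarrow> nat \<Rightarrow> table" where
  "core_table M a b d f g j =
    ([a + 12, b + 18, d, f + 1, g + 1, j, 0],
     [[(a + 12, M), (11, 4), (11, 4), (a + 11, 2), (a + 11, 2), (a + 11, 2), (0, M)],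
      [(11, 2), (b + 18, M), (17, 3), (11, 2), (11, 2), (11, 2), (0, M)],
      [(11, 2), (17, 1), (d, M), (11, 2), (11, 2), (11, 2), (0, M)],
      [(a + 11, 0), (11, 4), (11, 4), (f + 1, M), (f, 2), (f, 2), (0, M)],
      [(a + 11, 0), (11, 4), (11, 4), (f, 1), (g + 1, M), (g, 3), (0, M)],
      [(a + 11, 0), (11, 4), (11, 4), (f, 1), (g, 2), (j, M), (0, M)],
      [(0, 0), (0, 0), (0, 0), (0, 0), (0, 0), (0, 0), (0, M)]],
     [[(a + 12, M), (a, 3), (a, 3), (0, 1), (0, 2), (a, 3), (0, M)],
      [(a, 2), (b + 18, M), (b, 2), (0, 1), (0, 2), (b, 2), (0, M)],
      [(a, 2), (b, 1), (d, M), (0, 1), (0, 2), (d, 4), (0, M)],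
      [(0, 0), (0, 0), (0, 0), (f + 1, M), (0, 2), (0, 0), (0, M)],
      [(0, 0), (0, 0), (0, 0), (0, 1), (g + 1, M), (0, 0), (0, M)],
      [(a, 2), (b, 1), (d, M), (0, 1), (0, 2), (j, M), (0, M)],
      [(0, 0), (0, 0), (0, 0), (0, 1), (0, 2), (0, 0), (0, M)]],
     [[], [(11, 2)], [(11, 2), (17, 1)], [(a + 11, 0)], [(a + 11, 0), (f, 1)], [(a + 11, 0), (f, 1),
         (g, 2)],
      map (Pair 0) [0..<M]])"

text \<open>The last block is a prefix of \<open>L(n)\<close>.\<close>

fun tail_table :: "nat \<Rightarrow> nat \<Rightarrow> nat \<Rightarrow> nat \<Rightarrow> nat \<Rightarrow> nat \<Rightarrow> table" where
  "tail_table M n a b d i =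
    ([a + 12, b + 18, d, i],
     [[(a + 12, M), (11, 4), (11, 4), (0, n)],
      [(11, 2), (b + 18, M), (17, 3), (0, n)],
      [(11, 2), (17, 1), (d, M), (0, n)],
      [(0, 0), (0, 0), (0, 0), (i, M)]],
     [[(a + 12, M), (a, 3), (a, 3), (a, 3)],
      [(a, 2), (b + 18, M), (b, 2), (b, 2)],
      [(a, 2), (b, 1), (d, M), (d, 4)],
      [(a, 2), (b, 1), (d, M), (i, M)]],
     [[], [(11, 2)], [(11, 2), (17, 1)], map (Pair 0) [0..<n]])"

definition base_rows :: "nat list list" where
  "base_rows = [[0, 0], [1, 0, 1, 0], [2, 0, 1, 0, 2, 0, 1, 0]]"

definition tail_rows :: "nat list list" where "tail_rows = base_rows @ [[3, 0, 1, 0, 2, 0, 1, 0]]"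

definition core_rows :: "nat list list" where
  "core_rows = base_rows @ [[0, 3, 0, 3], [0, 3, 0, 4, 0, 3, 0, 4], [0, 3, 0, 4, 0, 3, 0, 5, 0, 1,
      0, 2, 0, 1, 0], [6]]"

text \<open>Starting with the empty block makes the separator \<open>M\<close> the first letter: the
  last word is \<open>M\<close> followed by the new \<open>J\<close>.\<close>

definition start_rows :: "nat list list" where
  "start_rows = base_rows @ [[6, 0, 3, 0, 4, 0, 3, 0, 5, 0, 1, 0, 2, 0, 1, 0]]"

text \<open>These inequalities settle all comparisons of symbolic lengths and are preserved by the
  recurrences. The bound on \<open>a\<close> is met from \<open>M = 6\<close> on, where
  \<open>a\<close> is 63 - 12 = 51.\<close>

lemma step_tail_ok:
  assumes "M \<ge> 6" "a \<ge> 50" "b \<ge> a" "d \<ge> b + 18" "i > d"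
  shows "step_ok 4 tail_rows (tail_table M n a b d i)"
  using assms
  by (simp add: tail_rows_def base_rows_def symbolic_eval)

lemma step_tail:
  assumes "M \<ge> 6" "n < M"
  shows "step M tail_rows (tail_table M n a b d i) = tail_table (Suc M) n (2 * a + 13)
      (2 * b + 2 * a + 45)
    (2 * d + 2 * b + 4 * a + 91) (i + d + 2 * b + 4 * a + 91)"
  using assms
  by (simp add: tail_rows_def base_rows_def symbolic_eval)

lemma step_core_ok:
  assumes "M \<ge> 6" "a \<ge> 50" "b \<ge> a" "d \<ge> b + 18" "f \<ge> a + 12" "g \<ge> f + 1" "j > d + f" "j > g + 1"
  shows "step_ok 7 core_rows (core_table M a b d f g j)"
  using assms
  by (simp add: core_rows_def base_rows_def symbolic_eval)

text \<open>The parameters are overlaps: \<open>a\<close> is the common suffix length of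
  \<open>ruler_init M\<close> and \<open>Q_word M\<close>, \<open>b\<close> that of
  \<open>Q_word M\<close> and \<open>D_word M\<close>; \<open>f\<close> and \<open>g\<close> are the
  common prefix lengths of \<open>A\<close>, \<open>B\<close> and of \<open>B\<close>,
  \<open>J\<close>; \<open>d\<close> and \<open>j\<close> are full lengths. The offsets 12, 18 and 1
  reach up to and including the first difference. An exception is just such a differing letter, so
  blocking can hold with equality, as in a + 12 <= Suc 11 + a.\<close>

lemma step_core:
  assumes "M \<ge> 6"
  shows "step M core_rows (core_table M a b d f g j) = core_table (Suc M) (2 * a + 13)
      (2 * b + 2 * a + 45)
    (2 * d + 2 * b + 4 * a + 91) (2 * f + 2 * a + 28) (2 * g + 2 * f + 4 * a + 58)
    (j + d + 2 * b + g + 2 * f + 8 * a + 149)"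
  using assms
  by (simp add: core_rows_def base_rows_def symbolic_eval)

lemma step_start_ok:
  assumes "M \<ge> 6" "a \<ge> 50" "b \<ge> a" "d \<ge> b + 18" "f \<ge> a + 12" "g \<ge> f + 1" "j > d + f" "j > g + 1"
  shows "step_ok 7 start_rows (core_table M a b d f g j)"
  using assms
  by (simp add: start_rows_def base_rows_def symbolic_eval)

lemma step_start:
  assumes "M \<ge> 6"
  shows "step M start_rows (core_table M a b d f g j) = tail_table (Suc M) M (2 * a + 13)
      (2 * b + 2 * a + 45)
    (2 * d + 2 * b + 4 * a + 91) (j + d + 2 * b + g + 2 * f + 8 * a + 150)"
  using assms
  by (simp add: start_rows_def base_rows_def symbolic_eval)

text \<open>The last numeric level has ten words; the core needs seven of them and each of L(3),
  L(4), L(5) needs four.\<close>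

definition select_table :: "nat list \<Rightarrow> table \<Rightarrow> table" where
  "select_table is T = (case T of (l, p, u, e) \<Rightarrow>
    (map (lookup l) is, map (\<lambda>i. map (lookup2 p i) is) is, map (\<lambda>i. map (lookup2 u i) is) is, map
        (lookup e) is))"

lemma represents_select_table:
  assumes "represents m ws T" "distinct is" "set is \<subseteq> {..<length ws}"
  shows "represents m (map (lookup ws) is) (select_table is T)"
proof -
  obtain l p u e where T: "T = (l, p, u, e)" by (cases T) auto
  have mem: "is ! i < length ws" if "i < length is" for i
    using assms(3) that by (meson lessThan_iff nth_mem subsetD)
  have lookup: "lookup (map f is) i = f (is ! i)" if "i < length is" for f :: "nat \<Rightarrow> 'b" and i
    using that by (simp add: lookup_def)
  have lookup2: "lookup2 (map (\<lambda>i. map (f i) is) is) i j = f (is ! i) (is ! j)"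
    if "i < length is" "j < length is" for f :: "nat \<Rightarrow> nat \<Rightarrow> 'b" and i j
    using that by (simp add: lookup2_def)
  have inj: "inj_on (lookup ws) {..<length ws}"
    using assms(1) by (auto simp: represents_def describes_def T)
  have "inj_on (lookup (map (lookup ws) is)) {..<length is}"
  proof (rule inj_onI)
    fix i j assume ij: "i \<in> {..<length is}" "j \<in> {..<length is}"
      "lookup (map (lookup ws) is) i = lookup (map (lookup ws) is) j"
    then have "lookup ws (is ! i) = lookup ws (is ! j)" by (simp add: lookup)
    then have "is ! i = is ! j" using inj mem ij by (auto simp: inj_on_def)
    then show "i = j" using assms(2) ij by (auto simp: distinct_conv_nth)
  qed
  with assms(1) show ?thesis
    unfolding represents_def describes_def T select_table_def
    by (auto simp: lookup lookup2 mem)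
qed

lemma representsD:
  assumes "represents m ws (l, p, u, e)" "i < length ws"
  shows "squarefree (lookup ws i)" "lookup l i = length (lookup ws i)" "unblocked m (lookup ws i)
      \<subseteq> set (lookup e i)"
    and "j < length ws \<Longrightarrow> lookup2 p i j = first_diff m (lookup ws i) (lookup ws j)"
    and "j < length ws \<Longrightarrow> lookup2 u i j = first_diff m (rev (lookup ws i)) (rev (lookup ws j))"
  using assms by (auto simp: represents_def describes_def)

section \<open>From tables to prefixes of L(n)\<close>

definition tail_good :: "nat \<Rightarrow> nat \<Rightarrow> nat list \<Rightarrow> bool" where
  "tail_good M n K \<longleftrightarrow> (\<exists>a b d i. represents M [ruler_init M, Q_word M, D_word M, K]
      (tail_table M n a b d i) \<and>
     M \<ge> 6 \<and> n < M \<and> a \<ge> 50 \<and> b \<ge> a \<and> d \<ge> b + 18 \<and> i > d)"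

lemma length4 [simp]: "length [x1, x2, x3, x4] = 4" by simp

text \<open>The table gives \<open>d\<close> both as the length of \<open>D_word M\<close> and as
  the length of its common suffix with \<open>K\<close>.\<close>

lemma tail_good_suffix:
  assumes "tail_good M n K"
  obtains Y where "K = Y @ D_word M"
proof -
  obtain a b d i where r: "represents M [ruler_init M, Q_word M, D_word M, K] (tail_table M n a b d i)"
    using assms unfolding tail_good_def by blast
  then have "d = length (D_word M)" "(d, 4) = first_diff M (rev (D_word M)) (rev K)"
    using representsD(2)[OF r[unfolded tail_table.simps], where i = 2]
      representsD(5)[OF r[unfolded tail_table.simps], where i = 2 and j =
          3] by (simp_all add: lookup_eval lookup2_eval)
  then have "suffix (drop 0 (D_word M)) K"
    by (intro suffix_drop_first_diff[of _ _ M]) (metis add_0 fst_conv order_refl)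
  then show ?thesis using that by (auto simp: suffix_def)
qed

text \<open>Since \<open>n < M\<close>, the entry \<open>(0, n)\<close> is a letter of
  \<open>K\<close> and not the end marker.\<close>

lemma tail_good_head:
  assumes "tail_good M n K"
  obtains K' where "K = n # K'"
proof -
  obtain a b d i where r: "represents M [ruler_init M, Q_word M, D_word M, K]
      (tail_table M n a b d i)" "n < M"
    using assms unfolding tail_good_def by blast
  then have "first_diff M (ruler_init M) K = (0, n)"
    using representsD(4)[OF r(1)[unfolded tail_table.simps], where i = 0 and j =
        3] by (simp add: lookup_eval lookup2_eval)
  with r(2) show ?thesis
    using that by (cases "ruler_init M"; cases K) (auto simp: map_prod_def split: if_splits prod.splits)
qed

lemma tail_good_step:
  assumes "tail_good M n (Y @ D_word M)"
  shows "tail_good (Suc M) n (Y @ D_word (Suc M))"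
proof -
  obtain a b d i where r: "represents M [ruler_init M, Q_word M, D_word M, Y @ D_word M]
      (tail_table M n a b d i)"
    and c: "M \<ge> 6" "n < M" "a \<ge> 50" "b \<ge> a" "d \<ge> b + 18" "i > d"
    using assms unfolding tail_good_def by blast
  have "represents (Suc M) (next_words M tail_rows [ruler_init M, Q_word M, D_word M, Y @ D_word M])
      (step M tail_rows (tail_table M n a b d i))"
    using r by (rule represents_step) (use c in \<open>simp only: length4 step_tail_ok\<close>)
  moreover have "next_words M tail_rows [ruler_init M, Q_word M, D_word M, Y @ D_word M] =
      [ruler_init (Suc M), Q_word (Suc M), D_word (Suc M), Y @ D_word (Suc M)]"
    by (simp add: next_words_def tail_rows_def base_rows_def lookup_eval ruler_init_Suc
        alpha_step[OF c(1)])
  ultimately have r': "represents (Suc M) [ruler_init (Suc M), Q_word (Suc M), D_word (Suc M), Y @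
      D_word (Suc M)]
      (step M tail_rows (tail_table M n a b d i))"
    by simp
  show ?thesis
    unfolding tail_good_def
    by (rule exI[of _ "2 * a + 13"], rule exI[of _ "2 * b + 2 * a + 45"],
        rule exI[of _ "2 * d + 2 * b + 4 * a + 91"], rule exI[of _ "i + d + 2 * b + 4 * a + 91"])
      (rule conjI[OF r'[unfolded step_tail[OF c(1,2)]]], use c in linarith)
qed

text \<open>The words \<open>Y @ D_word (M + k)\<close> are the prefixes required by
  \<open>L_eqI\<close>; all their exceptions sit at position 0, inside the given prefix
  \<open>[n]\<close>.\<close>

lemma L_tail_good:
  assumes "tail_good M n K"
  shows "\<exists>Y. L [n] = Y @- smorph rho (smorph alpha (L []))"
proof -
  obtain Y where K: "K = Y @ D_word M" by (rule tail_good_suffix[OF assms])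
  obtain K' where K': "K = n # K'" by (rule tail_good_head[OF assms])
  define x where "x = Y @- smorph rho (smorph alpha (L []))"
  have tail_good: "tail_good (M + k) n (Y @ D_word (M + k))" for k
  proof (induction k)
    case 0
    then show ?case using assms K by simp
  next
    case (Suc k)
    then show ?case using tail_good_step by simp
  qed
  have M: "M \<ge> 6" using assms by (auto simp: tail_good_def)
  have pre: "prefix_of (Y @ D_word (M + k)) x" for k
    using D_word_prefix[of "M + k"] M unfolding x_def prefix_of_iff by auto
  have "L [n] = x"
  proof (rule L_eqI)
    show "prefix_of [n] x"
      using prefix_of_prefix[of "[n]" K' x] pre[of 0] K K' by simp
    fix N
    obtain a b d i where r: "represents (M + N) [ruler_init (M + N), Q_word (M + N), D_word (M + N),
        Y @ D_word (M + N)] (tail_table (M + N) n a b d i)"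
      and c: "a \<ge> 50" "b \<ge> a" "d \<ge> b + 18" "i > d"
      using tail_good[of N] unfolding tail_good_def by blast
    have 1: "squarefree (Y @ D_word (M + N))" "unblocked (M + N) (Y @ D_word (M + N))
        \<subseteq> set (map (Pair 0) [0..<n])"
      "a + 12 = length (ruler_init (M + N))" "i = length (Y @ D_word (M + N))"
      using representsD(1-3)[OF r(1)[unfolded tail_table.simps], where i = 3]
        representsD(2)[OF r(1)[unfolded tail_table.simps], where i = 0] by (simp_all add: lookup_eval)
    have "N < 2 ^ N" by (rule less_exp)
    also have "(2 :: nat) ^ N \<le> 2 ^ (M + N)" by (rule power_increasing) auto
    finally have "N \<le> length (ruler_init (M + N))" by (simp add: length_ruler_init)
    then have "N \<le> length (Y @ D_word (M + N))" using 1 c by linarith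
    with 1 pre show "\<exists>u m. N \<le> length u \<and> prefix_of u x \<and> squarefree u \<and>
        (\<forall>(q, c)\<in>unblocked m u. q < length [n])"
      by (intro exI[of _ "Y @ D_word (M + N)"] exI[of _ "M + N"]) auto
  qed
  then show ?thesis unfolding x_def by blast
qed

definition core_good :: "nat \<Rightarrow> bool" where
  "core_good M \<longleftrightarrow> (\<exists>A B J a b d f g j.
     represents M [ruler_init M, Q_word M, D_word M, A, B, J, []] (core_table M a b d f g j) \<and>
     M \<ge> 6 \<and> a \<ge> 50 \<and> b \<ge> a \<and> d \<ge> b + 18 \<and> f \<ge> a + 12 \<and> g \<ge> f + 1 \<and> j > d + f \<and> j > g + 1)"

lemma length7 [simp]: "length [x1, x2, x3, x4, x5, x6, x7] = 7" by simp

text \<open>The words \<open>A\<close>, \<open>B\<close>, \<open>J\<close> stay existentially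
  quantified: only their table matters, while \<open>Q_word\<close> and \<open>D_word\<close> must
  be matched with \<open>alpha\<close>.\<close>

lemma core_good_step:
  assumes "core_good M"
  shows "core_good (Suc M)" "\<exists>K. tail_good (Suc M) M K"
proof -
  obtain A B J a b d f g j where
    r: "represents M [ruler_init M, Q_word M, D_word M, A, B, J, []] (core_table M a b d f g j)"
    and c: "M \<ge> 6" "a \<ge> 50" "b \<ge> a" "d \<ge> b + 18" "f \<ge> a + 12" "g \<ge> f + 1" "j > d + f" "j > g + 1"
    using assms unfolding core_good_def by blast
  let ?ws = "[ruler_init M, Q_word M, D_word M, A, B, J, []]"
  have "represents (Suc M) (next_words M core_rows ?ws) (step M core_rows (core_table M a b d f g j))"
    using r by (rule represents_step) (use c in \<open>simp only: length7 step_core_ok\<close>)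
  moreover have "\<exists>A' B' J'. next_words M core_rows ?ws = [ruler_init (Suc M), Q_word (Suc M), D_word
      (Suc M), A', B', J', []]"
    by (simp add: next_words_def core_rows_def base_rows_def lookup_eval ruler_init_Suc
        alpha_step[OF c(1)])
  ultimately obtain A' B' J' where r': "represents (Suc M) [ruler_init (Suc M), Q_word (Suc M),
      D_word (Suc M), A', B', J', []]
      (step M core_rows (core_table M a b d f g j))"
    by auto
  show "core_good (Suc M)"
    unfolding core_good_def
    by (rule exI[of _ A'], rule exI[of _ B'], rule exI[of _ J'], rule exI[of _ "2 * a + 13"],
        rule exI[of _ "2 * b + 2 * a + 45"], rule exI[of _ "2 * d + 2 * b + 4 * a + 91"],
        rule exI[of _ "2 * f + 2 * a + 28"], rule exI[of _ "2 * g + 2 * f + 4 * a + 58"],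
        rule exI[of _ "j + d + 2 * b + g + 2 * f + 8 * a + 149"])
      (rule conjI[OF r'[unfolded step_core[OF c(1)]]], use c in linarith)
  have "represents (Suc M) (next_words M start_rows ?ws) (step M start_rows (core_table M a b d f g j))"
    using r by (rule represents_step) (use c in \<open>simp only: length7 step_start_ok\<close>)
  moreover have "\<exists>K. next_words M start_rows ?ws = [ruler_init (Suc M), Q_word (Suc M), D_word (Suc
      M), K]"
    by (simp add: next_words_def start_rows_def base_rows_def lookup_eval ruler_init_Suc
        alpha_step[OF c(1)])
  ultimately obtain K where r': "represents (Suc M) [ruler_init (Suc M), Q_word (Suc M), D_word (Suc
      M), K]
      (step M start_rows (core_table M a b d f g j))"
    by auto
  show "\<exists>K. tail_good (Suc M) M K"
    unfolding tail_good_def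
    by (rule exI[of _ K], rule exI[of _ "2 * a + 13"], rule exI[of _ "2 * b + 2 * a + 45"],
        rule exI[of _ "2 * d + 2 * b + 4 * a + 91"], rule exI[of _ "j + d + 2 * b + g + 2 * f + 8 *
        a + 150"])
      (rule conjI[OF r'[unfolded step_start[OF c(1)]]], use c in linarith)
qed

lemma L_from_base:
  assumes A: "core_good 6" and I: "\<And>n. n \<in> {3, 4, 5} \<Longrightarrow> \<exists>K. tail_good 6 n K" and n: "n \<ge> 3"
  shows "\<exists>Y. L [n] = Y @- smorph rho (smorph alpha (L []))"
proof (cases "n \<ge> 6")
  case True
  then have "core_good n"
  proof (induction n rule: dec_induct)
    case base
    show ?case by (rule A)
  next
    case (step n)
    then show ?case using core_good_step(1) by simp
  qed
  then show ?thesis using core_good_step(2) L_tail_good by blast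
next
  case False
  then have "n \<in> {3, 4, 5}" using n by auto
  then show ?thesis using I L_tail_good by blast
qed

section \<open>The grammar of the initial words\<close>

text \<open>Row \<open>i\<close> of \<open>level k\<close> lists the words of the previous level that are joined with the letter \<open>k\<close>
  to form word \<open>i\<close>. The data were computed by the greedy algorithm and then cut. The words of the last
  level are \<open>ruler_init 6\<close>, \<open>Q_word 6\<close>, \<open>D_word 6\<close>, the words \<open>A\<close>, \<open>B\<close>, \<open>J\<close> for \<open>M = 6\<close>, the empty
  word, and the prefixes of \<open>L(3)\<close>, \<open>L(4)\<close>, \<open>L(5)\<close> before the first letter above \<open>5\<close>.\<close>

definition level0 :: "nat list list" where
  "level0 = [
    [0,0],
    [0]]"

definition level1 :: "nat list list" where
  "level1 = [
    [0,0],
    [0],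
    [0,1],
    [1,0,1],
    [1,0],
    [1]]"

definition level2 :: "nat list list" where
  "level2 = [
    [0,0],
    [0],
    [0,1],
    [1,0,1],
    [1],
    [1,0],
    [0,2,1,3,0,2,1,3],
    [0,2,1,3,0,2,1,4,0,3,0,2,1,3,0,2],
    [0,2,1,3,0,2,1,5],
    [0,2,1,3,0,2,1],
    [1,2,1,3,0,2,1,3,1,5],
    [1,2,1,3,0,2,1,3,1],
    [1,2,1,3,0,2,1,5],
    [1,2,1,3,0],
    [2,0,2,1,3,0,2,1,5],
    [2,1,3,0,2,1,3,0],
    [5]]"

definition level3 :: "nat list list" where
  "level3 = [
    [0,0],
    [0,1],
    [0],
    [1,0,1],
    [1],
    [1,0],
    [2,0,2,1,3,0,2,1,4],
    [0,2,1,3,0,2,1,3],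
    [0,2,1,3,0,2,1,5,0,3,0,2,1,3,0,2],
    [0,2,1,3,0,2,1,4],
    [0,2,1,3,0,2,1],
    [1,2,1,3,0,2,1,3,1,4],
    [1,2,1,3,0,2,1,4],
    [1,2,1,3,0],
    [0,6,0,6],
    [0,6,0,7,0,6,0,8,0,9,0,2,1,3,0,2,1,10,0,6,0,7,0,6,0,8,0,9,0,2,1,3,0,2,1,10],
    [0,6,0,7,0,6,0,8,0,9,0,2,1,3,0,2,1,10,0,6,0,7,0,6,0,8,0,9,0,2,1,3,0,2,1,11,0,2,1,3,0,2,1,12,0,6,0,
    7,0,6,0,8,0,9,0,2,1,3,0,2,1,10,0,6,0,7,0,6,0,8,0,9,0,2,1,3,0,2,1,12,0,6,0,7,0,6,0,8,0,9,0,2,1,3,0,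
    2,1,13,0,14,0,6,0,7,0,6,0,8,0,9,0,2,1,3,0,2,1,10,0,6,0,7,0,6,0,8,0,9,0,2,1,3,0,2,1,12,0,6,0,7,0,6,
    0,8,0,9,0,2,1,3,0,2,1,13,0,15,0,14,0,6,0,7,0,6,0,8,0,9,0,2,1,3,0,2,1,10,0,6,0,7,0,6,0,8,0,9,0,2,1,
    3,0,2,1,12,0,6,0,7,0,6,0,8,0,9,0,2,1,3,0,2,1,13,0,14,0,6,0,7,0,6,0,8,0,9,0,2,1,3,0,2,1,10,0,6,0,7,
    0,6,0,8,0,9,0,2,1,3,0,2,1,12,0,6,0,7,0,6,0,8,0,9,0,2,1,3,0,2,1],
    [2],
    [16],
    [16,0,6,0,7,0,6,0,8,0,9,0,2,1,3,0,2,1,10,0,6,0,7,0,6,0,8,0,9,0,2,1,3,0,2,1,11,0,2,1,3,0,2,1,12,0,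
    6,0,7,0,6,0,8,0,9,0,2,1,3,0,2,1,10,0,6,0,7,0,6,0,8,0,9,0,2,1,3,0,2,1,12,0,6,0,7,0,6,0,8,0,9,0,2,1,
    3,0,2,1,13,0,14,0,6,0,7,0,6,0,8,0,9,0,2,1,3,0,2,1,10,0,6,0,7,0,6,0,8,0,9,0,2,1,3,0,2,1,12,0,6,0,7,
    0,6,0,8,0,9,0,2,1,3,0,2,1,13,0,15,0,14,0,6,0,7,0,6,0,8,0,9,0,2,1,3,0,2,1,10,0,6,0,7,0,6,0,8,0,9,0,
    2,1,3,0,2,1,12,0,6,0,7,0,6,0,8,0,9,0,2,1,3,0,2,1,13,0,14,0,6,0,7,0,6,0,8,0,9,0,2,1,3,0,2,1,10,0,6,
    0,7,0,6,0,8,0,9,0,2,1,3,0,2,1,12,0,6,0,7,0,6,0,8,0,9,0,2,1,3,0,2,1]]"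

definition level4 :: "nat list list" where
  "level4 = [
    [0,0],
    [1,0,1,2,3,0,1,2,4],
    [0,1,2,3,0,1,2,3],
    [0,1,2,3,0,1,2,5,0,3,0,1,2,3,0,1],
    [0,1,2,3,0,1,2,4],
    [0,1,2,3,0,1,2],
    [0,2],
    [0],
    [2,0,2],
    [2,1,2,3,0,1,2,3,2,4],
    [2,1,2,3,0,1,2,4],
    [2,1,2,3,0],
    [1,6,0,7,0,8,0,7,0,9,0,10,0,1,2,3,0,1,2,11,0,7,0,8,0,7,0,9,0,10,0,1,2,3,0,1,2,12,0,7,0,8,0,7,0,9,
    0,10,0,1,2,3,0,1,2,13,0,6,0,7,0,8,0,7,0,9,0,10,0,1,2,3,0,1,2,11,0,7,0,8,0,7,0,9,0,10,0,1,2,3,0,1,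
    2,12,0,7,0,8,0,7,0,9,0,10,0,1,2,3,0,1,2,13,1,2,3,0,1,2,3,6,0,7,0,8,0,7,0,9,0,10,0,1,2,3,0,1,2,11,
    0,7,0,8,0,7,0,9,0,10,0,1,2,3,0,1,2,12,0,7,0,8,0,7,0,9,0,10,0,1,2,3,0,1,2,13,0,6,0,7,0,8,0,7,0,9,0,
    10,0,1,2,3,0,1,2,11,0,7,0,8,0,7,0,9,0,10,0,1,2,3,0,1,2,12,0,7,0,8,0,7,0,9,0,10,0,1,2,3,0,1,2,13,1,
    2,3,0,1,2,4],
    [0,14,0,14],
    [0,14,0,15,0,14,0,15],
    [0,14,0,15,0,14,0,16,0,1,2,3,0,1,2,11,0,7,0,8,0,7,0,9,0,10,0,1,2,3,0,1,2,11,0,7,0,8,0,7,0,9,0],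
    [7,0,7,0],
    [7,0,8,0,7,0,9,0,10,0,1,2,3,0,1,2,11,0,7,0,8,0,7,0,9,0,10,0,1,2,3,0,1,2,11,0],
    [7,0,8,0,7,0,9,0,10,0,1,2,3,0,1,2,11,0,7,0,8,0,7,0,9,0,10,0,1,2,3,0,1,2,12,0,7,0,8,0,7,0,9,0,10,0,
    1,2,3,0,1,2,13,0,6,0,7,0,8,0,7,0,9,0,10,0,1,2,3,0,1,2,11,0,7,0,8,0,7,0,9,0,10,0,1,2,3,0,1,2,12,0,
    7,0,8,0,7,0,9,0,10,0,1,2,3,0,1,2,13,0,6,0],
    [7,0,8,0,7,0,9,0,10,0,1,2,3,0,1,2,11,0,7,0,8,0,7,0,9,0,10,0,1,2,3,0,1,2,12,0,7,0,8,0,7,0,9,0,10,0,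
    1,2,3,0,1,2,13,0,6,0,7,0,8,0,7,0,9,0,10,0,1,2,3,0,1,2,11,0,7,0,8,0,7,0,9,0,10,0,1,2,3,0,1,2,12,0,
    7,0,8,0,7,0,9,0,10,0,1,2,3,0,1,2,13,0,17,3,0,1,2,3,0,1,6,0,7,0,8,0,7,0,9,0,10,0,1,2,3,0,1,2,11,0,
    7,0,8,0,7,0,9,0,10,0,1,2,3,0,1,2,12,0,7,0,8,0,7,0,9,0,10,0,1,2,3,0,1,2,13,0,6,0,7,0,8,0,7,0,9,0,
    10,0,1,2,3,0,1,2,11,0,7,0,8,0,7,0,9,0,10,0,1,2,3,0,1,2,12,0,7,0,8,0,7,0,9,0,10,0,1,2,3,0,1,2,13,1,
    2,3,0,1,2,3,6,0,7,0,8,0,7,0,9,0,10,0,1,2,3,0,1,2,11,0,7,0,8,0,7,0,9,0,10,0,1,2,3,0,1,2,12,0,7,0,8,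
    0,7,0,9,0,10,0,1,2,3,0,1,2,13,0,6,0,7,0,8,0,7,0,9,0,10,0,1,2,3,0,1,2,11,0,7,0,8,0,7,0,9,0,10,0,1,
    2,3,0,1,2,12,0,7,0,8,0,7,0,9,0,10,0,1,2,3,0,1,2,13,1,2,3,0,1,2,4],
    [18],
    [19,0,1,2,3,0,1,2,11,0,7,0,8,0,7,0,9,0,10,0,1,2,3,0,1,2,11,0,7,0,8,0,7,0,9,0],
    [18,0,14,0,15,0,14,0,16,0,1,2,3,0,1,2,11,0,7,0,8,0,7,0,9,0,10,0,1,2,3,0,1,2,11,0,7,0,8,0,7,0,9,0]]"

definition level5 :: "nat list list" where
  "level5 = [
    [0,0],
    [1,0,2,0,3,0,2,0,4,0,5,0,6,7,8,0,6,7,9,0,2,0,3,0,2,0,4,0,5,0,6,7,8,0,6,7,10,0,2,0,3,0,2,0,4,0,5,0,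
    6,7,8,0,6,7,11,0,1,0,2,0,3,0,2,0,4,0,5,0,6,7,8,0,6,7,9,0,2,0,3,0,2,0,4,0,5,0,6,7,8,0,6,7,10,0,2,0,
    3,0,2,0,4,0,5,0,6,7,8,0,6,7,11,0],
    [12,0,2,0,3,0,2,0,4,0,5,0,6,7,8,0,6,7,9,0,2,0,3,0,2,0,4,0,5,0,6,7,8,0,6,7,10,0,2,0,3,0,2,0,4,0,5,
    0,6,7,8,0,6,7,11,0,1,0,2,0,3,0,2,0,4,0,5,0,6,7,8,0,6,7,9,0,2,0,3,0,2,0,4,0,5,0,6,7,8,0,6,7,10,0,2,
    0,3,0,2,0,4,0,5,0,6,7,8,0,6,7,11,0,12,0,2,0,3,0,2,0,4,0,5,0,6,7,8,0,6,7,9,0,2,0,3,0,2,0,4,0,5,0,6,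
    7,8,0,6,7,10,0,2,0,3,0,2,0,4,0,5,0,6,7,8,0,6,7,11,0,1,0,2,0,3,0,2,0,4,0,5,0,6,7,8,0,6,7,9,0,2,0,3,
    0,2,0,4,0,5,0,6,7,8,0,6,7,10,0,2,0,3,0,2,0,4,0,5,0,6,7,8,0,6,7,11,0],
    [0,13,0,13],
    [0,13,0,14,0,13,0,14],
    [0,13,0,14,0,13,0,15,0,16,0,17,0,16,0,18,0,16,0,17,0,16,0,19,0,2,0,3,0,2,0,4,0,5,0,6,7,8,0,6,7,9,
    0,2,0,3,0,2,0,4,0,5,0,6,7,8,0,6,7,10,0,2,0,3,0,2,0,4,0,5,0,6,7,8,0,6,7,11,0,1,0,2,0,3,0,2,0,4,0,5,
    0,6,7,8,0,6,7,9,0,2,0,3,0,2,0,4,0,5,0,6,7,8,0,6,7,10,0,2,0,3,0,2,0,4,0,5,0,6,7,8,0,6,7,11,0,12,0,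
    2,0,3,0,2,0,4,0,5,0,6,7,8,0,6,7,9,0,2,0,3,0,2,0,4,0,5,0,6,7,8,0,6,7,10,0,2,0,3,0,2,0,4,0,5,0,6,7,
    8,0,6,7,11,0,1,0,2,0,3,0,2,0,4,0,5,0,6,7,8,0,6,7,9,0,2,0,3,0,2,0,4,0,5,0,6,7,8,0,6,7,10,0,2,0,3,0,
    2,0,4,0,5,0,6,7,8,0,6,7,11,0],
    [20],
    [21,0,16,0,17,0,16,0,18,0,16,0,17,0,16,0,19,0,2,0,3,0,2,0,4,0,5,0,6,7,8,0,6,7,9,0,2,0,3,0,2,0,4,0,
    5,0,6,7,8,0,6,7,10,0,2,0,3,0,2,0,4,0,5,0,6,7,8,0,6,7,11,0,1,0,2,0,3,0,2,0,4,0,5,0,6,7,8,0,6,7,9,0,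
    2,0,3,0,2,0,4,0,5,0,6,7,8,0,6,7,10,0,2,0,3,0,2,0,4,0,5,0,6,7,8,0,6,7,11,0,12,0,2,0,3,0,2,0,4,0,5,
    0,6,7,8,0,6,7,9,0,2,0,3,0,2,0,4,0,5,0,6,7,8,0,6,7,10,0,2,0,3,0,2,0,4,0,5,0,6,7,8,0,6,7,11,0,1,0,2,
    0,3,0,2,0,4,0,5,0,6,7,8,0,6,7,9,0,2,0,3,0,2,0,4,0,5,0,6,7,8,0,6,7,10,0,2,0,3,0,2,0,4,0,5,0,6,7,8,
    0,6,7,11,0],
    [22,0,16,0,17,0,16,0,18,0,16,0,17,0,16,0,19,0,2,0,3,0,2,0,4,0,5,0,6,7,8,0,6,7,9,0,2,0,3,0,2,0,4,0,
    5,0,6,7,8,0,6,7,10,0,2,0,3,0,2,0,4,0,5,0,6,7,8,0,6,7,11,0,1,0,2,0,3,0,2,0,4,0,5,0,6,7,8,0,6,7,9,0,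
    2,0,3,0,2,0,4,0,5,0,6,7,8,0,6,7,10,0,2,0,3,0,2,0,4,0,5,0,6,7,8,0,6,7,11,0,12,0,2,0,3,0,2,0,4,0,5,
    0,6,7,8,0,6,7,9,0,2,0,3,0,2,0,4,0,5,0,6,7,8,0,6,7,10,0,2,0,3,0,2,0,4,0,5,0,6,7,8,0,6,7,11,0,1,0,2,
    0,3,0,2,0,4,0,5,0,6,7,8,0,6,7,9,0,2,0,3,0,2,0,4,0,5,0,6,7,8,0,6,7,10,0,2,0,3,0,2,0,4,0,5,0,6,7,8,
    0,6,7,11,0],
    [20,0,13,0,14,0,13,0,15,0,16,0,17,0,16,0,18,0,16,0,17,0,16,0,19,0,2,0,3,0,2,0,4,0,5,0,6,7,8,0,6,7,
    9,0,2,0,3,0,2,0,4,0,5,0,6,7,8,0,6,7,10,0,2,0,3,0,2,0,4,0,5,0,6,7,8,0,6,7,11,0,1,0,2,0,3,0,2,0,4,0,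
    5,0,6,7,8,0,6,7,9,0,2,0,3,0,2,0,4,0,5,0,6,7,8,0,6,7,10,0,2,0,3,0,2,0,4,0,5,0,6,7,8,0,6,7,11,0,12,
    0,2,0,3,0,2,0,4,0,5,0,6,7,8,0,6,7,9,0,2,0,3,0,2,0,4,0,5,0,6,7,8,0,6,7,10,0,2,0,3,0,2,0,4,0,5,0,6,
    7,8,0,6,7,11,0,1,0,2,0,3,0,2,0,4,0,5,0,6,7,8,0,6,7,9,0,2,0,3,0,2,0,4,0,5,0,6,7,8,0,6,7,10,0,2,0,3,
    0,2,0,4,0,5,0,6,7,8,0,6,7,11,0]]"

section \<open>Evaluation of the six levels\<close>

definition table0 :: table where "table0 = ruler_table 0 0"

\<comment> \<open>The unknown is instantiated by the normal form that the simplifier reaches. Its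
  first component is the verdict for this level, its second the table for the next one, so no table
  has to be written out.\<close>
schematic_goal check_step0: "check_step 1 0 level0 table0 = ?T"
  unfolding level0_def table0_def ruler_table.simps
  by (simp add: eval_simps cong: eval_cong del: eval_del)

definition table1 :: table where "table1 = snd (check_step 1 0 level0 table0)"

lemmas table1_eq = check_step0[THEN arg_cong[where f = snd], folded table1_def, unfolded snd_conv]
lemmas ok0 = check_step0[THEN arg_cong[where f = fst], unfolded check_step_def fst_conv]

schematic_goal check_step1: "check_step 2 1 level1 table1 = ?T"
  unfolding level1_def table1_eq
  by (simp add: eval_simps cong: eval_cong del: eval_del)

definition table2 :: table where "table2 = snd (check_step 2 1 level1 table1)"

lemmas table2_eq = check_step1[THEN arg_cong[where f = snd], folded table2_def, unfolded snd_conv]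
lemmas ok1 = check_step1[THEN arg_cong[where f = fst], unfolded check_step_def fst_conv]

schematic_goal check_step2: "check_step 6 2 level2 table2 = ?T"
  unfolding level2_def table2_eq
  by (simp add: eval_simps cong: eval_cong del: eval_del)

definition table3 :: table where "table3 = snd (check_step 6 2 level2 table2)"

lemmas table3_eq = check_step2[THEN arg_cong[where f = snd], folded table3_def, unfolded snd_conv]
lemmas ok2 = check_step2[THEN arg_cong[where f = fst], unfolded check_step_def fst_conv]

schematic_goal check_step3: "check_step 17 3 level3 table3 = ?T"
  unfolding level3_def table3_eq
  by (simp add: eval_simps cong: eval_cong del: eval_del)

definition table4 :: table where "table4 = snd (check_step 17 3 level3 table3)"

lemmas table4_eq = check_step3[THEN arg_cong[where f = snd], folded table4_def, unfolded snd_conv]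
lemmas ok3 = check_step3[THEN arg_cong[where f = fst], unfolded check_step_def fst_conv]

schematic_goal check_step4: "check_step 20 4 level4 table4 = ?T"
  unfolding level4_def table4_eq
  by (simp add: eval_simps cong: eval_cong del: eval_del)

definition table5 :: table where "table5 = snd (check_step 20 4 level4 table4)"

lemmas table5_eq = check_step4[THEN arg_cong[where f = snd], folded table5_def, unfolded snd_conv]
lemmas ok4 = check_step4[THEN arg_cong[where f = fst], unfolded check_step_def fst_conv]

schematic_goal check_step5: "check_step 23 5 level5 table5 = ?T"
  unfolding level5_def table5_eq
  by (simp add: eval_simps cong: eval_cong del: eval_del)

definition table6 :: table where "table6 = snd (check_step 23 5 level5 table5)"

lemmas table6_eq = check_step5[THEN arg_cong[where f = snd], folded table6_def, unfolded snd_conv]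
lemmas ok5 = check_step5[THEN arg_cong[where f = fst], unfolded check_step_def fst_conv]

section \<open>The initial words and the morphism alpha\<close>

definition level :: "nat \<Rightarrow> nat list list" where
  "level k = lookup [level0, level1, level2, level3, level4, level5] k"

primrec block_words :: "nat \<Rightarrow> nat list list" where
  "block_words 0 = [[]]"
| "block_words (Suc k) = next_words k (level k) (block_words k)"

text \<open>The first argument of \<open>spells\<close> below is the stack of a machine that unfolds a word and compares it
  letter by letter with literal chunks, which are loaded one at a time.\<close>

datatype item = Letter nat | Word nat nat | Seq nat "nat list"

fun spell :: "item \<Rightarrow> nat list" where
  "spell (Letter c) = [c]"
| "spell (Word k i) = lookup (block_words k) i"
| "spell (Seq k s) = join k (map (lookup (block_words k)) s)"

definition spells :: "item list \<Rightarrow> nat list \<Rightarrow> nat list list \<Rightarrow> bool" where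
  "spells K v cs \<longleftrightarrow> concat (map spell K) = v @ concat cs"

text \<open>A copy of \<open>spells\<close> whose congruence rule lets the chunk \<open>v\<close> be
  evaluated to a literal list before comparison starts; \<open>spells_open\<close> does the same for
  a row of the grammar. In \<open>spells\<close> itself all arguments are left untouched.\<close>

definition spells_load :: "item list \<Rightarrow> nat list \<Rightarrow> nat list list \<Rightarrow> bool" where
  "spells_load = spells"

definition spells_open :: "nat \<Rightarrow> nat list \<Rightarrow> item list \<Rightarrow> nat list \<Rightarrow> nat list list \<Rightarrow> bool" where
  "spells_open k s K v cs = spells (Seq k s # K) v cs"

lemma lookup_words_Suc:
  "i < length (level k) \<Longrightarrow> lookup (block_words (Suc k)) i =
    join k (map (lookup (block_words k))
      (lookup (level k) i))"
  by (simp add: next_words_def lookup_def)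

lemma spells_open_word:
  "i < length (level k) \<Longrightarrow> spells (Word (Suc k) i # K) v cs = spells_open k (lookup (level k) i) K v cs"
  by (simp add: spells_def spells_open_def next_words_def lookup_def)

lemma level_eval:
  "level 0 = level0" "level (Suc 0) = level1" "level 1 = level1" "level 2 = level2" "level 3 = level3"
  "level 4 = level4" "level 5 = level5"
  by (simp_all add: level_def lookup_eval)

lemma length_levels:
  "length level0 = 2" "length level1 = 6" "length level2 = 17" "length level3 = 20" "length level4 = 23"
  "length level5 = 10"
  by (simp_all add: level0_def level1_def level2_def level3_def level4_def level5_def)

lemma spells_word:
  "i < 2 \<Longrightarrow> spells (Word 1 i # K) v cs = spells_open 0 (lookup level0 i) K v cs"
  "i < 6 \<Longrightarrow> spells (Word 2 i # K) v cs = spells_open 1 (lookup level1 i) K v cs"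
  "i < 17 \<Longrightarrow> spells (Word 3 i # K) v cs = spells_open 2 (lookup level2 i) K v cs"
  "i < 20 \<Longrightarrow> spells (Word 4 i # K) v cs = spells_open 3 (lookup level3 i) K v cs"
  "i < 23 \<Longrightarrow> spells (Word 5 i # K) v cs = spells_open 4 (lookup level4 i) K v cs"
  using spells_open_word[of i 0] spells_open_word[of i 1] spells_open_word[of i 2]
    spells_open_word[of i 3] spells_open_word[of i 4]
  by (simp_all only: level_eval length_levels Suc_numeral add_num_simps Suc_1 One_nat_def[symmetric])

lemma spells_eval:
  "spells [] [] [] = True"
  "spells (Letter c # K) (x # v) cs = (if c = x then spells K v cs else False)"
  "spells (Seq k [a] # K) v cs = spells (Word k a # K) v cs"
  "spells (Seq k (a # b # s) # K) v cs = spells (Word k a # Letter k # Seq k (b # s) # K) v cs"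
  "spells (Word 0 0 # K) v cs = spells K v cs"
  "spells (Letter c # K) [] (d # cs) = spells_load (Letter c # K) d cs"
  "spells_load K (x # v) cs = spells K (x # v) cs"
  "spells_open k [a] K v cs = spells (Word k a # K) v cs"
  "spells_open k (a # b # s) K v cs = spells (Word k a # Letter k # Seq k (b # s) # K) v cs"
  by (simp_all add: spells_def spells_load_def spells_open_def lookup_def)

lemma spells_cong:
  "spells K v cs = spells K v cs"
  "v = v' \<Longrightarrow> spells_load K v cs = spells_load K v' cs"
  "s = s' \<Longrightarrow> spells_open k s K v cs = spells_open k s' K v cs"
  by simp_all

lemmas level_rows =
  level0_def[THEN arg_cong[where f = lookup], THEN fun_cong]
  level1_def[THEN arg_cong[where f = lookup], THEN fun_cong]
  level2_def[THEN arg_cong[where f = lookup], THEN fun_cong]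
  level3_def[THEN arg_cong[where f = lookup], THEN fun_cong]
  level4_def[THEN arg_cong[where f = lookup], THEN fun_cong]
  level5_def[THEN arg_cong[where f = lookup], THEN fun_cong]

section \<open>Literal values of the pieces of \<open>alpha\<close>\<close>

lemma morph_rho_eval: "morph rho [] = []" "morph rho (a # w) = 0 # (a + 1) # morph rho w"
  by (simp_all add: rho_def)

lemma morph_cong: "morph f w = morph f w"
  by (rule refl)

lemma P0_eval: "P0 1 = [0, 1]" "P0 2 = [0,1,0,2,0,1]" "P0 3 = [0,1,0,2,0,1,0,3,0,1,0,2,0,1]"
  by (simp_all add: P0_def drop_last_def ruler_def numeral_eq_Suc rho_def)

schematic_goal psi_eval:
  "psi1 0 = ?w0" "psi1 1 = ?w1" "psi1 2 = ?w2"
  by (simp_all add: psi1_def P0_eval del: One_nat_def)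

schematic_goal P1_3: "P1 3 = ?w"
  by (simp add: P1_def P0_eval psi_eval del: One_nat_def)

schematic_goal psi2_1: "psi2 1 = ?w"
  by (simp add: psi2_def P0_eval P1_3 del: One_nat_def)

schematic_goal B0_parts:
  "drop_last 3 (morph psi1 [1, 0, 1, 0]) = ?u"
  "drop 3 (drop_last 3 (morph psi1 [1, 0, 1, 0])) = ?u'"
  "drop_last 6 psi2_zero = ?v"
  "drop_last 12 psi2_zero = ?w"
  "drop_last 15 psi2_zero = ?w'"
  "take_last 3 (drop_last 12 psi2_zero) = ?x"
  by (simp_all add: psi_eval psi_eval(2)[unfolded One_nat_def] drop_last_def take_last_def
      psi2_zero_def)

lemma drop_last_append: "drop_last k (u @ v) = (if k \<le> length v then u @ drop_last k v else
    drop_last (k - length v) u)"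
  by (simp add: drop_last_def)

text \<open>Cuts are moved into the outer pieces before anything is expanded: 9 letters are 301020
  and three more, 5 letters leave only the 3 of 301020, and 7 letters at the front are 0301 and
  three more.\<close>

lemma B0_concat:
  "B0 = concat [[0, 3, 0, 1], drop_last 3 (morph psi1 [1, 0, 1, 0]), psi2 1, psi2_zero, psi2 1,
      drop_last 6 psi2_zero, psi2 1, drop_last 12 psi2_zero, [3, 0, 1, 0, 2, 0]]" (is ?A)
  and drop_last_B0_concat:
  "drop_last 9 B0 = concat [[0, 3, 0, 1], drop_last 3 (morph psi1 [1, 0, 1, 0]), psi2 1, psi2_zero,
      psi2 1,
      drop_last 6 psi2_zero, psi2 1, drop_last 15 psi2_zero]" (is ?B)
  and B0_core_concat:
  "drop 7 (drop_last 5 B0) = concat [drop 3 (drop_last 3 (morph psi1 [1, 0, 1, 0])), psi2 1,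
      psi2_zero, psi2 1,
      drop_last 6 psi2_zero, psi2 1, drop_last 12 psi2_zero, [3]]" (is ?C)
  and take_last_B0: "take_last 9 B0 = take_last 3 (drop_last 12 psi2_zero) @ [3, 0, 1, 0, 2, 0]" (is ?D)
proof -
  define u where "u = drop_last 3 (morph psi1 [1, 0, 1, 0])"
  have lu: "length u = 23" unfolding u_def B0_parts(1) by simp
  have lz: "length psi2_zero = 199" by (simp add: psi2_zero_def)
  define z where "z = drop_last 12 psi2_zero"
  have lz': "length z = 187" using lz by (simp add: z_def drop_last_def)
  have z15: "drop_last 15 psi2_zero = drop_last 3 z"
    using lz by (simp add: z_def drop_last_def)
  have "morph psi2 [1, 0] = psi2 1 @ psi2_zero"
    "morph psi2 [1, 0, 1, 0] = psi2 1 @ psi2_zero @ psi2 1 @ psi2_zero"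
    by (simp_all add: psi2_def)
  then have B0: "B0 = concat [[0, 3, 0, 1], u, psi2 1, psi2_zero, psi2 1,
      drop_last 6 psi2_zero, psi2 1, z, [3, 0, 1, 0, 2, 0]]"
    using lz by (simp add: B0_def drop_last_append u_def z_def del: morph_simps)
  then show ?A by (simp only: u_def z_def)
  have d9: "drop_last 9 (w @ z @ [3, 0, 1, 0, 2, 0]) = w @ drop_last 3 z" for w
    using lz' by (simp add: drop_last_append)
  have d5: "drop_last 5 (w @ z @ [3, 0, 1, 0, 2, 0]) = w @ z @ [3]" for w
    using lz' by (simp add: drop_last_append) (simp add: drop_last_def)
  have t9: "take_last 9 (w @ z @ [3, 0, 1, 0, 2, 0]) = take_last 3 z @ [3, 0, 1, 0, 2, 0]" for w
    using lz' by (simp add: take_last_def)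
  have split: "B0 = ([0, 3, 0, 1] @ u @ psi2 1 @ psi2_zero @ psi2 1 @ drop_last 6 psi2_zero @ psi2
      1) @ z @ [3, 0, 1, 0, 2, 0]"
    by (simp add: B0)
  show ?B unfolding split d9 z15 u_def[symmetric] by simp
  show ?C unfolding split d5 z15 u_def[symmetric] z_def[symmetric] using lu by simp
  show ?D unfolding split t9 z_def[symmetric] by simp
qed

schematic_goal B0_eq: "B0 = ?w"
  unfolding B0_concat unfolding B0_parts psi2_1 unfolding psi2_zero_def by simp

schematic_goal drop_last_B0: "drop_last 9 B0 = ?w"
  unfolding drop_last_B0_concat unfolding B0_parts psi2_1 unfolding psi2_zero_def by simp

schematic_goal B0_core: "drop 7 (drop_last 5 B0) = ?w"
  unfolding B0_core_concat unfolding B0_parts psi2_1 unfolding psi2_zero_def by simp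

schematic_goal take_B0_core: "take 21 (drop 7 (drop_last 5 B0)) = ?w"
  unfolding B0_core by simp

schematic_goal drop_B0_core: "drop 21 (drop 7 (drop_last 5 B0)) = ?w"
  unfolding B0_core by simp

schematic_goal F_eq: "F_word = ?w"
  unfolding F_word_def take_last_B0 B0_parts(6) by (simp add: C_word_def inc_last_def)

text \<open>The 21st letter is the first 3, the initial letter of \<open>psi2 1\<close> after 20
  letters from \<open>psi1\<close>. Applying \<open>rho\<close> twice turns it into the first 5, so
  the split of \<open>B1\<close> is at the first cut of \<open>morph rho B1\<close>.\<close>

definition B1_head :: "nat list" where "B1_head = morph rho (take 21 (drop 7 (drop_last 5 B0)))"
definition B1_tail :: "nat list" where "B1_tail = morph rho (drop 21 (drop 7 (drop_last 5 B0)))"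

lemma B1_split: "B1 = B1_head @ B1_tail"
  unfolding B1_def B1_head_def B1_tail_def morph_simps(3)[symmetric] by (simp only: append_take_drop_id)

schematic_goal rho_B0: "morph rho B0 = ?w"
  unfolding B0_eq by (simp add: morph_rho_eval cong: morph_cong del: morph_simps)

schematic_goal rho_drop_last_B0: "morph rho (drop_last 9 B0) = ?w"
  unfolding drop_last_B0 by (simp add: morph_rho_eval cong: morph_cong del: morph_simps)

schematic_goal rho_F: "morph rho F_word = ?w"
  unfolding F_eq by (simp add: morph_rho_eval cong: morph_cong del: morph_simps)

schematic_goal B1_head_eq: "B1_head = ?w"
  unfolding B1_head_def take_B0_core by (simp add: morph_rho_eval cong: morph_cong del: morph_simps)

schematic_goal B1_tail_eq: "B1_tail = ?w"
  unfolding B1_tail_def drop_B0_core by (simp add: morph_rho_eval cong: morph_cong del: morph_simps)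

schematic_goal rho_B1_head: "morph rho B1_head = ?w"
  unfolding B1_head_eq by (simp add: morph_rho_eval cong: morph_cong del: morph_simps)

schematic_goal rho_B1_tail: "morph rho B1_tail = ?w"
  unfolding B1_tail_eq by (simp add: morph_rho_eval cong: morph_cong del: morph_simps)

lemma spells_C: "spells [Word 5 1, Letter 5] [] [morph rho C_word, morph rho B1_head]"
  unfolding rho_B1_head C_word_def
  by (simp add: lookup_eval level_rows spells_word spells_eval morph_rho_eval
      cong: eval_cong(1) spells_cong morph_cong del: morph_simps)

lemma spells_E_F: "spells [Word 5 12, Letter 5] []
    [morph rho [0, 1, 0, 2], morph rho B0, morph rho [1], morph rho (drop_last 9 B0), morph rho F_word,
     morph rho [0, 1, 0, 2], morph rho B0, morph rho [1], morph rho (drop_last 9 B0), morph rho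
         B1_head]"
  by (simp add: lookup_eval level_rows spells_word spells_eval morph_rho_eval
      rho_B0 rho_drop_last_B0 rho_F rho_B1_head
      cong: eval_cong(1) spells_cong morph_cong del: morph_simps)

text \<open>The 54 blocks into which \<open>morph rho B1_tail\<close> splits at the letter 5; its
  own final 5 is the separator after them.\<close>

definition block_tail :: "nat list" where "block_tail = take 54 (drop 1 (lookup level5 1))"

schematic_goal block_tail_eq: "block_tail = ?w"
  unfolding block_tail_def by (simp add: lookup_eval level_rows cong: eval_cong(1))

lemma spells_tail: "spells [Seq 5 block_tail, Letter 5] [] [morph rho B1_tail]"
  unfolding rho_B1_tail block_tail_eq
  by (simp add: lookup_eval level_rows spells_word spells_eval morph_rho_eval
      cong: eval_cong(1) spells_cong morph_cong del: morph_simps)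

lemma spells_Nil: "spells [Word 5 20] [] []"
  by (simp add: lookup_eval level_rows spells_word spells_eval cong: eval_cong(1) spells_cong)

lemma level5_rows:
  "lookup level5 0 = [0, 0]"
  "lookup level5 1 = (1 # block_tail) @ [0] @ (1 # block_tail) @ [0]"
  "lookup level5 2 = (12 # block_tail) @ [0] @ (1 # block_tail) @ [0] @ (12 # block_tail) @ [0] @ (1
      # block_tail) @ [0]"
  "lookup level5 6 = [20]"
  unfolding block_tail_eq by (simp_all add: lookup_eval level_rows cong: eval_cong(1))

lemma block_words_ruler: "k \<le> 6 \<Longrightarrow> lookup (block_words k) 0 = ruler_init k"
proof (induction k)
  case 0
  show ?case by (simp add: lookup_def)
next
  case (Suc k)
  then have "k \<in> {0, 1, 2, 3, 4, 5}" by auto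
  moreover have "level5 \<noteq> []" by (simp add: level5_def)
  ultimately have "lookup (level k) 0 = [0, 0] \<and> 0 < length (level k)"
    by (auto simp: level_eval length_levels level0_def level1_def level2_def level3_def level4_def
        level5_rows(1) lookup_eval)
  then show ?case
    using Suc by (simp only: lookup_words_Suc) (simp add: ruler_init_join)
qed

text \<open>At the cut 5, \<open>rho\<close> of \<open>C_word @ B1\<close> is block 1 and
  \<open>rho\<close> of \<open>alpha 0 @ B1\<close> is block 12, each followed by
  \<open>block_tail\<close>, since the part of \<open>B1\<close> before its first cut is absorbed
  into the first block. \<open>Q_word 6\<close> comes from \<open>alpha 1\<close>, and
  \<open>D_word 6\<close> from the images of 0, 1, 0 (that is, \<open>ruler_init 2\<close>) followed
  by \<open>butlast (alpha 1)\<close>.\<close>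

lemma level5_words:
  "lookup (block_words 6) 1 = Q_word 6" "lookup (block_words 6) 2 = D_word 6"
      "lookup (block_words 6) 6 = []"
proof -
  define b where "b s = join 5 (map (lookup (block_words 5)) (s # block_tail))" for s
  have tail: "join 5 (map (lookup (block_words 5)) block_tail) @ [5] = morph rho B1_tail"
    using spells_tail by (simp add: spells_def)
  have ne: "block_tail \<noteq> []" by (simp add: block_tail_eq)
  have b: "b s @ [5] = lookup (block_words 5) s @ [5] @ morph rho B1_tail" for s
    unfolding tail[symmetric] b_def using ne by (simp add: join_Cons)
  have "b 1 @ [5] = (lookup (block_words 5) 1 @ [5]) @ morph rho B1_tail" using b by simp
  also have "lookup (block_words 5) 1 @ [5] = morph rho C_word @ morph rho B1_head"
    using spells_C by (simp add: spells_def)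
  finally have b1: "morph rho (C_word @ B1) = b 1 @ [5]" by (simp add: B1_split)
  have "b 12 @ [5] = (lookup (block_words 5) 12 @ [5]) @ morph rho B1_tail" using b by simp
  also have "lookup (block_words 5) 12 @ [5] = morph rho (alpha 0 @ B1_head)"
    using spells_E_F by (simp add: spells_def E_word_def)
  finally have b12: "morph rho (alpha 0 @ B1) = b 12 @ [5]" by (simp add: B1_split)
  have R5: "morph rho (ruler 4) = ruler_init 5 @ [5]"
    using ruler_Suc[of 4] ruler_eq[of 5] by simp
  have R4: "ruler 4 = ruler_init 4 @ [4]" "morph rho (ruler_init 4) @ [0] = ruler_init 5"
    using ruler_eq[of 4] ruler_init_Suc_rho[of 4] by simp_all
  have w5: "lookup (block_words 5) 0 = ruler_init 5" by (rule block_words_ruler) simp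
  have six: "block_words 6 = block_words (Suc 5)" by simp
  have al: "alpha 1 = B1 @ ruler 4 @ C_word @ B1 @ ruler 4" by simp
  have bal: "butlast (alpha 1) = B1 @ ruler 4 @ C_word @ B1 @ ruler_init 4"
    unfolding al unfolding R4 by (simp add: butlast_append)
  have append_Cons_not_Nil: "(a # u) @ v \<noteq> []" for a :: nat and u v by simp
  have j: "join 5 (map (lookup (block_words 5)) ((s # block_tail) @ [0] @ u)) =
      b s @ [5] @ ruler_init 5 @ [5] @ join 5 (map (lookup (block_words 5)) u)"
    if "u \<noteq> []" for s u
  proof -
    have "map (lookup (block_words 5)) ((s # block_tail) @ [0] @ u) =
        map (lookup (block_words 5)) (s # block_tail) @ (ruler_init 5 # map (lookup (block_words 5)) u)"
      by (simp add: w5)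
    then show ?thesis using that
      using join_append[of "map (lookup (block_words 5)) (s # block_tail)"
          "ruler_init 5 # map (lookup (block_words 5)) u" 5]
      by (simp add: b_def join_Cons del: list.map(2))
  qed
  have j': "join 5 (map (lookup (block_words 5)) ((s # block_tail) @ [0])) =
      b s @ [5] @ ruler_init 5" for s
  proof -
    have "map (lookup (block_words 5)) ((s # block_tail) @ [0]) = map (lookup (block_words 5))
        (s # block_tail) @ [ruler_init 5]"
      by (simp add: w5)
    then show ?thesis
      using join_append[of "map (lookup (block_words 5)) (s # block_tail)"
          "[ruler_init 5]" 5] by (simp add: b_def del: list.map(2))
  qed
  have diff_row: "lookup (block_words 6) i = join 5 (map (lookup (block_words 5))
      (lookup level5 i))" if "i < 10" for i
    unfolding six using lookup_words_Suc[of i 5] that by (simp only: level_eval length_levels)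
  have "lookup (block_words 6) 1 = b 1 @ [5] @ ruler_init 5 @ [5] @ b 1 @ [5] @ ruler_init 5"
    unfolding diff_row[of 1, simplified, folded One_nat_def] level5_rows j[OF append_Cons_not_Nil] j' ..
  moreover have "Q_word 6 = morph rho (C_word @ B1) @ morph rho (ruler 4) @ morph rho (C_word @ B1)
      @ morph rho (ruler_init 4) @ [0]"
  proof -
    have "6 - 5 = (1::nat)" by simp
    then show ?thesis unfolding Q_word_def by (simp only: bal morph_simps append_assoc)
  qed
  ultimately show "lookup (block_words 6) 1 = Q_word 6"
    by (simp only: b1 R5 R4(2)) simp
  have "lookup (block_words 6) 2 = b 12 @ [5] @ ruler_init 5 @ [5] @ b 1 @ [5] @ ruler_init 5 @ [5]
      @ b 12 @ [5] @ ruler_init 5 @ [5] @ b 1 @ [5] @ ruler_init 5"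
    unfolding diff_row[of 2, simplified] level5_rows j[OF append_Cons_not_Nil] j' ..
  moreover have "D_word 6 = morph rho (alpha 0 @ B1) @ morph rho (ruler 4) @ morph rho (C_word @ B1)
      @ morph rho (ruler 4) @
      morph rho (alpha 0 @ B1) @ morph rho (ruler 4) @ morph rho (C_word @ B1) @ morph rho
          (ruler_init 4) @ [0]"
  proof -
    have "6 - 5 = (1::nat)" "6 - 4 = (2::nat)" by simp_all
    moreover have "ruler_init 2 = [0, 1, 0]" by (simp add: numeral_eq_Suc ruler_init_Suc)
    moreover have "morph alpha [0, 1, 0] = alpha 0 @ alpha 1 @ alpha 0" by simp
    ultimately show ?thesis
      unfolding D_word_def by (simp only: bal) (simp only: al morph_simps append_assoc append_Nil2)
  qed
  ultimately show "lookup (block_words 6) 2 = D_word 6"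
    by (simp only: b1 b12 R5 R4(2)) simp
  show "lookup (block_words 6) 6 = []"
    using spells_Nil by (simp add: diff_row level5_rows spells_def)
qed

section \<open>The base case M = 6\<close>

lemma length_block_words: "length (block_words (Suc k)) = length (level k)"
  by (simp add: next_words_def)

lemma length_block_words_eval:
  "length (block_words 0) = 1" "length (block_words 1) = 2" "length (block_words 2) =
      6" "length (block_words 3) = 17"
  "length (block_words 4) = 20" "length (block_words 5) = 23" "length (block_words 6) = 10"
  using length_block_words[of 0] length_block_words[of 1] length_block_words[of 2]
      length_block_words[of 3] length_block_words[of 4]
    length_block_words[of 5]
  by (simp_all only: block_words.simps(1) list.size level_eval length_levels Suc_numeral
      add_num_simps Suc_1
      One_nat_def[symmetric] add_0)

lemma represents_block_words_step:
  assumes "represents k (block_words k) T" "length (block_words k) = n" "level k = S"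
    "step_ok n S T = True" "k' = Suc k"
  shows "represents k' (block_words k') (snd (check_step n k S T))"
  using represents_step[of k "block_words k" T "level k"] assms by (simp add: check_step_def)

lemma represents_block_words: "represents 6 (block_words 6) table6"
proof -
  have "represents 0 (block_words 0) table0"
    using represents_0 by (simp only: block_words.simps table0_def)
  then have "represents 1 (block_words 1) table1"
    unfolding table1_def by (rule represents_block_words_step[OF _ length_block_words_eval(1)
        level_eval(1) ok0]) simp
  then have "represents 2 (block_words 2) table2"
    unfolding table2_def by (rule represents_block_words_step[OF _ length_block_words_eval(2)
        level_eval(3) ok1]) simp
  then have "represents 3 (block_words 3) table3"
    unfolding table3_def by (rule represents_block_words_step[OF _ length_block_words_eval(3)
        level_eval(4) ok2]) simp
  then have "represents 4 (block_words 4) table4"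
    unfolding table4_def by (rule represents_block_words_step[OF _ length_block_words_eval(4)
        level_eval(5) ok3]) simp
  then have "represents 5 (block_words 5) table5"
    unfolding table5_def by (rule represents_block_words_step[OF _ length_block_words_eval(5)
        level_eval(6) ok4]) simp
  then show ?thesis
    unfolding table6_def by (rule represents_block_words_step[OF _ length_block_words_eval(6)
        level_eval(7) ok5]) simp
qed

lemma core_good_6: "core_good 6"
proof -
  have "represents 6 (map (lookup (block_words 6)) [0, 1, 2, 3, 4, 5, 6])
      (select_table [0, 1, 2, 3, 4, 5, 6] table6)"
    by (rule represents_select_table[OF represents_block_words]) (simp_all add: length_block_words_eval)
  moreover have "map (lookup (block_words 6)) [0, 1, 2, 3, 4, 5, 6] =
      [ruler_init 6, Q_word 6, D_word 6, lookup (block_words 6) 3, lookup (block_words 6) 4, lookup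
          (block_words 6) 5, []]"
    using block_words_ruler[of 6] level5_words by simp
  \<comment> \<open>The six nonempty words have lengths 63, 6391, 25647, 399, 2951 and 42146; the
    parameters are these minus the offsets 12, 18, 0, 1, 1, 0.\<close>
  moreover have "select_table [0, 1, 2, 3, 4, 5, 6] table6 = core_table 6 51 6373 25647 398 2950 42146"
    by (simp add: select_table_def table6_eq lookup_eval lookup2_eval upt_rec)
  ultimately have "represents 6 [ruler_init 6, Q_word 6, D_word 6, lookup (block_words 6) 3, lookup
      (block_words 6) 4, lookup (block_words 6) 5, []]
      (core_table 6 51 6373 25647 398 2950 42146)"
    by metis
  then show ?thesis
    unfolding core_good_def by (intro exI conjI) (assumption, simp_all)
qed

lemma tail_good_6:
  assumes "n \<in> {3, 4, 5}"
  shows "\<exists>K. tail_good 6 n K"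
proof -
  have sel: "represents 6 [ruler_init 6, Q_word 6, D_word 6, lookup (block_words 6) k]
      (select_table [0, 1, 2, k] table6)"
    if "k \<in> {7, 8, 9}" for k
  proof -
    have "represents 6 (map (lookup (block_words 6)) [0, 1, 2, k]) (select_table [0, 1, 2, k] table6)"
      by (rule represents_select_table[OF represents_block_words])
          (use that in \<open>auto simp: length_block_words_eval\<close>)
    then show ?thesis using block_words_ruler[of 6] level5_words by simp
  qed
  have tail_good: "tail_good 6 n (lookup (block_words 6) k)"
    if "k \<in> {7, 8, 9}" "select_table [0, 1, 2, k] table6 = tail_table 6 n 51 6373 25647 i"
        "i > 25647" "n < 6" for k n i
    using sel[OF that(1)] that(3,4) unfolding that(2) tail_good_def by (intro exI conjI)
        (assumption, simp_all)
  \<comment> \<open>The last parameters are the lengths of the prefixes of L(3), L(4), L(5). The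
    third is 42146 + 1, as that prefix is 5 followed by \<open>J\<close>.\<close>
  have "select_table [0, 1, 2, 7] table6 = tail_table 6 3 51 6373 25647 39717"
    "select_table [0, 1, 2, 8] table6 = tail_table 6 4 51 6373 25647 40439"
    "select_table [0, 1, 2, 9] table6 = tail_table 6 5 51 6373 25647 42147"
    by (simp_all add: select_table_def table6_eq lookup_eval lookup2_eval upt_rec)
  then have "tail_good 6 3 (lookup (block_words 6) 7)" "tail_good 6 4 (lookup (block_words 6) 8)"
      "tail_good 6 5 (lookup (block_words 6) 9)"
    by (auto intro!: tail_good simp del: tail_table.simps)
  with assms show ?thesis by auto
qed

theorem theorem1p2:
  fixes n :: nat
  assumes "n \<ge> 3"
  shows "\<exists>Y :: nat list. L [n] = Y @- smorph rho (smorph alpha (L []))"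
  using L_from_base[OF core_good_6 tail_good_6 assms] .

end
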